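(* Let $(X_t)_{t\ge0}$ be a Lévy-type process in $\mathbb{R}^d$ with characteristics $(b(x),Q(x),\nu(x,dy))$, $x\in\mathbb{R}^d$, and denote by $\tau_r^x:=\inf\{t\ge0:|X_t-x|\ge r\}$ the first exit time from the open ball $B(x,r)$. Then $$\mathbb{P}^x(\tau_r^x\ge t)\le\frac{1}{1+tG(x,2r)}\quad\text{with}\quad G(x,r):=\inf_{|z-x|\le r}\nu(z,\{|y|>r\})$$ for all $x\in\mathbb{R}^d$, $t>0$ and $r>0$.
   Context: A Lévy-type operator $A$ with characteristics $(b(x),Q(x),\nu(x,dy))$, $x\in\mathbb{R}^d$, is an operator $$Ag(x)=b(x)\cdot\nabla g(x)+\tfrac12\operatorname{tr}(Q(x)\nabla^2g(x))+\int_{y\ne0}\left(g(x+y)-g(x)-y\cdot\nabla g(x)\mathbf 1_{(0,1)}(|y|)\right)\nu(x,dy),\quad g\in C_c^\infty(\mathbb{R}^d),$$ where for each $x$: $b(x)\in\mathbb{R}^d$, $Q(x)\in\mathbb{R}^{d\times d}$ is positive semi-definite and $\nu(x,\cdot)$ is a measure on $\mathbb{R}^d\setminus\{0\}$ with $\int\min\{1,|y|^2\}\,\nu(x,dy)<\infty$. Its symbol is $$q(x,\xi)=-ib(x)\cdot\xi+\tfrac12\xi\cdot Q(x)\xi+\int_{y\ne0}\left(1-e^{iy\cdot\xi}+iy\cdot\xi\mathbf 1_{(0,1)}(|y|)\right)\nu(x,dy).$$ A Lévy-type process with symbol $q$ (and characteristics $(b,Q,\nu)$) is a family $(X_t,t\ge0;\mathbb{P}^x,x\in\mathbb{R}^d)$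 with càdlàg paths in $\mathbb{R}^d$ such that (i) it is a strong Markov process; (ii) for each $x$, under $\mathbb{P}^x$ one has $X_0=x$ a.s. and $g(X_t)-g(X_0)-\int_0^tAg(X_s)\,ds$ is a martingale with respect to $\mathcal F_t=\sigma(X_s;s\le t)$ for every $g\in C_c^\infty(\mathbb{R}^d)$; (iii) $q$ is locally bounded. Notation: $\nu(z,\{|y|>r\}):=\nu(z,\{y:|y|>r\})$. *)

theory Defs
  imports "HOL-Probability.Probability"
begin

section \<open>Test functions\<close>

definition partial_deriv :: "'d::finite \<Rightarrow> (real^'d \<Rightarrow> real) \<Rightarrow> real^'d \<Rightarrow> real" where
  "partial_deriv i g x = frechet_derivative g (at x) (axis i 1)"

primrec C_k :: "nat \<Rightarrow> (real^'d::finite \<Rightarrow> real) \<Rightarrow> bool" where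
  "C_k 0 g \<longleftrightarrow> continuous_on UNIV g"
| "C_k (Suc k) g \<longleftrightarrow> (\<forall>x. g differentiable (at x)) \<and> (\<forall>i. C_k k (partial_deriv i g))"

definition Cc_infinity :: "(real^'d::finite \<Rightarrow> real) set" where
  "Cc_infinity = {g. (\<forall>k. C_k k g) \<and> compact (closure {x. g x \<noteq> 0})}"

definition grad :: "(real^'d::finite \<Rightarrow> real) \<Rightarrow> real^'d \<Rightarrow> real^'d" where
  "grad g x = (\<chi> i. partial_deriv i g x)"

definition hessian :: "(real^'d::finite \<Rightarrow> real) \<Rightarrow> real^'d \<Rightarrow> real^'d^'d" where
  "hessian g x = (\<chi> i j. partial_deriv i (partial_deriv j g) x)"

section \<open>Levy-type operators and their symbols\<close>

text \<open>Positive semi-definite matrices are symmetric by convention.  The measures \<open>nu x\<close> live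
  on the Borel sets of the punctured space, so an integral with respect to \<open>nu x\<close> ranges
  over \<open>y \<noteq> 0\<close>.\<close>

definition positive_semidefinite :: "real^'d^'d::finite \<Rightarrow> bool" where
  "positive_semidefinite S \<longleftrightarrow> transpose S = S \<and> (\<forall>\<xi>. 0 \<le> \<xi> \<bullet> (S *v \<xi>))"

definition levy_measure :: "(real^'d::finite) measure \<Rightarrow> bool" where
  "levy_measure m \<longleftrightarrow> sets m = sets (restrict_space borel (- {0})) \<and>
     (\<integral>\<^sup>+ y. ennreal (min 1 ((norm y)\<^sup>2)) \<partial>m) < \<infinity>"

definition levy_characteristics ::
    "(real^'d::finite \<Rightarrow> real^'d^'d) \<Rightarrow> (real^'d \<Rightarrow> (real^'d) measure) \<Rightarrow> bool" where
  "levy_characteristics Q nu \<longleftrightarrow> (\<forall>x. positive_semidefinite (Q x) \<and> levy_measure (nu x))"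

definition levy_operator ::
    "(real^'d::finite \<Rightarrow> real^'d) \<Rightarrow> (real^'d \<Rightarrow> real^'d^'d) \<Rightarrow> (real^'d \<Rightarrow> (real^'d) measure) \<Rightarrow>
     (real^'d \<Rightarrow> real) \<Rightarrow> real^'d \<Rightarrow> real" where
  "levy_operator b Q nu g x =
     b x \<bullet> grad g x + 1/2 * trace (Q x ** hessian g x) +
     (\<integral>y. g (x + y) - g x - (y \<bullet> grad g x) * indicator {0<..<1} (norm y) \<partial>nu x)"

definition levy_symbol ::
    "(real^'d::finite \<Rightarrow> real^'d) \<Rightarrow> (real^'d \<Rightarrow> real^'d^'d) \<Rightarrow> (real^'d \<Rightarrow> (real^'d) measure) \<Rightarrow>
     real^'d \<Rightarrow> real^'d \<Rightarrow> complex" where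
  "levy_symbol b Q nu x \<xi> =
     - \<i> * complex_of_real (b x \<bullet> \<xi>) + complex_of_real (1/2 * (\<xi> \<bullet> (Q x *v \<xi>))) +
     (\<integral>y. 1 - exp (\<i> * complex_of_real (y \<bullet> \<xi>)) +
           \<i> * complex_of_real (y \<bullet> \<xi>) * indicator {0<..<1} (norm y) \<partial>nu x)"

definition locally_bounded :: "('a::topological_space \<Rightarrow> 'b::real_normed_vector) \<Rightarrow> bool" where
  "locally_bounded f \<longleftrightarrow> (\<forall>K. compact K \<longrightarrow> bounded (f ` K))"

section \<open>Processes\<close>

text \<open>Time is a real number, meaningful only when nonnegative.  The filtration and random times
  are indexed by \<open>ennreal\<close>, so that a random time may be infinite; the sigma-algebra with
  index \<open>\<infinity>\<close> is generated by the whole process.\<close>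

definition natural_filtration :: "'w set \<Rightarrow> (real \<Rightarrow> 'w \<Rightarrow> 'e::topological_space) \<Rightarrow> ennreal \<Rightarrow> 'w measure"
  where "natural_filtration \<Omega> X t =
    sigma \<Omega> {X s -` B \<inter> \<Omega> | s B. 0 \<le> s \<and> ennreal s \<le> t \<and> B \<in> sets borel}"

definition cadlag :: "(real \<Rightarrow> 'e::topological_space) \<Rightarrow> bool" where
  "cadlag f \<longleftrightarrow> (\<forall>t\<ge>0. (f \<longlongrightarrow> f t) (at_right t)) \<and> (\<forall>t>0. \<exists>l. (f \<longlongrightarrow> l) (at_left t))"

definition martingale :: "'w measure \<Rightarrow> (ennreal \<Rightarrow> 'w measure) \<Rightarrow> (real \<Rightarrow> 'w \<Rightarrow> real) \<Rightarrow> bool" where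
  "martingale M F Y \<longleftrightarrow>
     (\<forall>t\<ge>0. Y t \<in> borel_measurable (F (ennreal t)) \<and> integrable M (Y t)) \<and>
     (\<forall>s t. 0 \<le> s \<longrightarrow> s \<le> t \<longrightarrow> (AE \<omega> in M. real_cond_exp M (F (ennreal s)) (Y t) \<omega> = Y s \<omega>))"

text \<open>\<open>M\<close> carries only the common measurable space of the probability measures \<open>P x\<close>; its own
  measure is irrelevant.\<close>

definition cadlag_family ::
    "'w measure \<Rightarrow> (real \<Rightarrow> 'w \<Rightarrow> 'e::topological_space) \<Rightarrow> ('e \<Rightarrow> 'w measure) \<Rightarrow> bool" where
  "cadlag_family M X P \<longleftrightarrow>
     (\<forall>x. prob_space (P x) \<and> sets (P x) = sets M) \<and>
     (\<forall>t\<ge>0. X t \<in> measurable M borel) \<and>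
     (\<forall>\<omega>\<in>space M. cadlag (\<lambda>t. X t \<omega>))"

text \<open>The strong Markov property
  \<open>E\<^sup>x[f(X\<^bsub>T+t\<^esub>) | F\<^sub>T] = E\<^bsup>X\<^sub>T\<^esup>[f(X\<^sub>t)]\<close> on \<open>{T < \<infinity>}\<close>, for stopping times \<open>T\<close> of the natural
  filtration.\<close>

definition strong_markov ::
    "'w measure \<Rightarrow> (real \<Rightarrow> 'w \<Rightarrow> 'e::topological_space) \<Rightarrow> ('e \<Rightarrow> 'w measure) \<Rightarrow> bool" where
  "strong_markov M X P \<longleftrightarrow>
     (\<forall>t\<ge>0. \<forall>B\<in>sets borel. (\<lambda>x. emeasure (P x) (X t -` B \<inter> space M)) \<in> borel_measurable borel) \<and>
     (\<forall>T. stopping_time (natural_filtration (space M) X) T \<longrightarrow>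
       (\<forall>x. \<forall>t\<ge>0. \<forall>f :: 'e \<Rightarrow> real. f \<in> borel_measurable borel \<longrightarrow> bounded (range f) \<longrightarrow>
         (AE \<omega> in P x. T \<omega> < \<infinity> \<longrightarrow>
            real_cond_exp (P x)
              (filtration.pre_sigma (space M) (natural_filtration (space M) X) T)
              (\<lambda>\<omega>'. if T \<omega>' < \<infinity> then f (X (enn2real (T \<omega>') + t) \<omega>') else 0) \<omega>
            = (\<integral>\<omega>'. f (X t \<omega>') \<partial>P (X (enn2real (T \<omega>)) \<omega>)))))"

text \<open>The integral of \<open>Ag(X\<^sub>s)\<close> over \<open>[0,t]\<close> that occurs in the martingale condition is
  required to exist almost surely: the Bochner integral of a non-integrable function is \<open>0\<close>.\<close>

definition solves_martingale_problem ::
    "'w measure \<Rightarrow> (real \<Rightarrow> 'w \<Rightarrow> real^'d::finite) \<Rightarrow> 'w measure \<Rightarrow> real^'d \<Rightarrow>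
     ((real^'d \<Rightarrow> real) \<Rightarrow> real^'d \<Rightarrow> real) \<Rightarrow> bool" where
  "solves_martingale_problem M X Px x A \<longleftrightarrow>
     (AE \<omega> in Px. X 0 \<omega> = x) \<and>
     (\<forall>g\<in>Cc_infinity.
        (\<forall>t\<ge>0. AE \<omega> in Px. set_integrable lborel {0..t} (\<lambda>s. A g (X s \<omega>))) \<and>
        martingale Px (natural_filtration (space M) X)
          (\<lambda>t \<omega>. g (X t \<omega>) - g (X 0 \<omega>) - (LBINT s:{0..t}. A g (X s \<omega>))))"

definition levy_type_process ::
    "'w measure \<Rightarrow> (real \<Rightarrow> 'w \<Rightarrow> real^'d::finite) \<Rightarrow> (real^'d \<Rightarrow> 'w measure) \<Rightarrow>
     (real^'d \<Rightarrow> real^'d) \<Rightarrow> (real^'d \<Rightarrow> real^'d^'d) \<Rightarrow> (real^'d \<Rightarrow> (real^'d) measure) \<Rightarrow> bool" where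
  "levy_type_process M X P b Q nu \<longleftrightarrow>
     levy_characteristics Q nu \<and>
     cadlag_family M X P \<and>
     strong_markov M X P \<and>
     (\<forall>x. solves_martingale_problem M X (P x) x (levy_operator b Q nu)) \<and>
     locally_bounded (\<lambda>(x, \<xi>). levy_symbol b Q nu x \<xi>)"

section \<open>Exit times\<close>

definition exit_time :: "(real \<Rightarrow> 'w \<Rightarrow> 'e::real_normed_vector) \<Rightarrow> 'e \<Rightarrow> real \<Rightarrow> 'w \<Rightarrow> ennreal" where
  "exit_time X x r \<omega> = Inf (ennreal ` {t. 0 \<le> t \<and> r \<le> norm (X t \<omega> - x)})"

definition G_lower :: "(real^'d::finite \<Rightarrow> (real^'d) measure) \<Rightarrow> real^'d \<Rightarrow> real \<Rightarrow> ennreal" where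
  "G_lower nu x r = (INF z\<in>cball x r. emeasure (nu z) {y. r < norm y})"

text \<open>The entrance time of a cadlag process into a closed set need not be measurable with respect
  to the sigma-algebra generated by the process, but by the debut theorem the event \<open>t \<le> \<tau>\<close>
  belongs to the completion under each \<open>P x\<close>, and its probability is understood there.  The outer
  measure extends the completed measure to all sets, and unlike \<open>emeasure\<close> it does not assign
  the value \<open>0\<close> to sets that are not measurable.\<close>

lemma outer_measure_of_eq_emeasure_completion:
  assumes "A \<in> sets (completion M)"
  shows "outer_measure_of M A = emeasure (completion M) A"
proof (rule antisym)
  from assms obtain S N N' where A: "A = S \<union> N" "N \<subseteq> N'" "N' \<in> null_sets M" "S \<in> sets M"
    by (auto elim: sets_completionE)
  have "outer_measure_of M A \<le> outer_measure_of M (S \<union> N')"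
    by (rule outer_measure_of_mono) (use A in auto)
  also have "\<dots> = emeasure M S"
    using A by (simp add: emeasure_Un_null_set null_setsD2 sets.Un)
  also have "\<dots> = emeasure (completion M) S"
    using A by simp
  also have "\<dots> \<le> emeasure (completion M) A"
    by (rule emeasure_mono) (use A assms in auto)
  finally show "outer_measure_of M A \<le> emeasure (completion M) A" .
next
  show "emeasure (completion M) A \<le> outer_measure_of M A"
    unfolding outer_measure_of_def
  proof (rule INF_greatest)
    fix B assume "B \<in> {B \<in> sets M. A \<subseteq> B}"
    then have B: "B \<in> sets M" "A \<subseteq> B" by auto
    then have "emeasure (completion M) A \<le> emeasure (completion M) B"
      by (intro emeasure_mono) auto
    then show "emeasure (completion M) A \<le> emeasure M B"
      using B by simp
  qed
qed

end

theory Submission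
  imports Defs
begin

text \<open>The process runs until it leaves the closed ball \<open>cball x r\<close>. Dynkin's formula is applied to
  smooth cutoffs \<open>g\<^sub>n\<close> that equal \<open>1\<close> near \<open>cball x r\<close> and converge to its indicator: on \<open>cball x r\<close>
  one has \<open>- A g\<^sub>n z = \<integral> (1 - g\<^sub>n (z + y)) \<nu>(z, dy)\<close>, whose limit inferior is at least
  \<open>\<nu>(z, {|y| > 2 r}) \<ge> G(x, 2 r)\<close>, since a jump of length more than \<open>2 r\<close> leaves the ball. If \<open>E\<^sub>u\<close> is the
  event that the process stays in the ball up to time \<open>u\<close>, this gives \<open>P(E\<^sub>u) (1 + u G(x, 2 r)) \<le> 1\<close>.
  The bound follows as \<open>u\<close> increases to \<open>t\<close>, because \<open>{\<tau> \<ge> t}\<close> is contained in each \<open>E\<^sub>u\<close>, \<open>u < t\<close>.\<close>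

section \<open>Smooth cutoff functions\<close>

lemma partial_deriv_has_derivative:
  "(g has_derivative g') (at x) \<Longrightarrow> partial_deriv i g x = g' (axis i 1)"
  by (simp add: partial_deriv_def frechet_derivative_at[symmetric])

text \<open>Derivatives are unique, so any explicit derivative may stand in for the
  \<open>frechet_derivative\<close> on which \<open>C_k\<close> is built.\<close>

lemma C_k_SucI:
  assumes "\<And>x. (g has_derivative g' x) (at x)"
    and "\<And>i. C_k k (\<lambda>x. g' x (axis i 1))"
  shows "C_k (Suc k) g"
proof -
  have "partial_deriv i g = (\<lambda>x. g' x (axis i 1))" for i
    using partial_deriv_has_derivative[OF assms(1)] by auto
  then show ?thesis
    using assms by (auto simp: differentiable_def)
qed

lemma C_k_has_derivative:
  "C_k (Suc k) g \<Longrightarrow> (g has_derivative frechet_derivative g (at x)) (at x)"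
  by (simp add: frechet_derivative_works)

lemma C_k_SucD: "C_k (Suc k) g \<Longrightarrow> C_k k g"
proof (induction k arbitrary: g)
  case 0
  then show ?case
    by (auto simp: continuous_on_eq_continuous_at differentiable_imp_continuous_within)
next
  case (Suc k)
  then show ?case by (metis C_k.simps(2))
qed

lemma C_k_const: "C_k k (\<lambda>x. c)"
proof (induction k arbitrary: c)
  case (Suc k)
  show ?case by (rule C_k_SucI[where g' = "\<lambda>x h. 0"]) (auto simp: Suc)
qed auto

lemma C_k_inner: "C_k k (\<lambda>y. v \<bullet> (y - x))"
proof (cases k)
  case 0
  then show ?thesis by (auto intro!: continuous_intros)
next
  case (Suc m)
  have "C_k (Suc m) (\<lambda>y. v \<bullet> (y - x))"
    by (rule C_k_SucI[where g' = "\<lambda>y h. v \<bullet> h"]) (auto intro!: derivative_eq_intros C_k_const)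
  then show ?thesis using Suc by simp
qed

lemma C_k_norm_square: "C_k k (\<lambda>y. (y - x) \<bullet> (y - x))"
proof (cases k)
  case 0
  then show ?thesis by (auto intro!: continuous_intros)
next
  case (Suc m)
  have "C_k m (\<lambda>y. 2 * (axis i 1 \<bullet> (y - x)))" for i
    using C_k_inner[of m "2 *\<^sub>R axis i 1" x] by simp
  then have "C_k (Suc m) (\<lambda>y. (y - x) \<bullet> (y - x))"
    by (intro C_k_SucI[where g' = "\<lambda>y h. 2 * (h \<bullet> (y - x))"])
       (auto intro!: derivative_eq_intros simp: inner_commute)
  then show ?thesis using Suc by simp
qed

lemma C_k_add: "C_k k f \<Longrightarrow> C_k k g \<Longrightarrow> C_k k (\<lambda>x. f x + g x)"
proof (induction k arbitrary: f g)
  case 0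
  then show ?case by (auto intro!: continuous_intros)
next
  case (Suc k)
  have "C_k k (\<lambda>x. partial_deriv i f x + partial_deriv i g x)" for i
    using Suc by auto
  moreover have "((\<lambda>x. f x + g x) has_derivative
      (\<lambda>h. frechet_derivative f (at x) h + frechet_derivative g (at x) h)) (at x)" for x
    by (intro has_derivative_add C_k_has_derivative[OF Suc.prems(1)] C_k_has_derivative[OF Suc.prems(2)])
  ultimately show ?case
    unfolding partial_deriv_def by (rule C_k_SucI[rotated])
qed

lemma C_k_mult: "C_k k f \<Longrightarrow> C_k k g \<Longrightarrow> C_k k (\<lambda>x. f x * g x)"
proof (induction k arbitrary: f g)
  case 0
  then show ?case by (auto intro!: continuous_intros)
next
  case (Suc k)
  have "C_k k (\<lambda>x. f x * partial_deriv i g x + partial_deriv i f x * g x)" for i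
    using Suc C_k_SucD[OF Suc.prems(1)] C_k_SucD[OF Suc.prems(2)] by (auto intro!: C_k_add)
  moreover have "((\<lambda>x. f x * g x) has_derivative
      (\<lambda>h. f x * frechet_derivative g (at x) h + frechet_derivative f (at x) h * g x)) (at x)" for x
    by (intro has_derivative_mult C_k_has_derivative[OF Suc.prems(1)] C_k_has_derivative[OF Suc.prems(2)])
  ultimately show ?case
    unfolding partial_deriv_def by (rule C_k_SucI[rotated])
qed

text \<open>The whole sequence of successive derivatives \<open>D\<close> is carried along so that
  the induction can stay general in \<open>j\<close>: the chain rule turns \<open>D j\<close> into
  \<open>D (Suc j)\<close> times a partial derivative of \<open>h\<close>, and
  \<open>C_k_mult\<close> handles the product.\<close>

lemma C_k_compose:
  assumes D: "\<And>j t. (D j has_real_derivative D (Suc j) t) (at t)"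
    and h: "\<And>k. C_k k h"
  shows "C_k k (\<lambda>y. D j (h y))"
proof (induction k arbitrary: j)
  case 0
  have "continuous_on UNIV (D j)"
    by (meson D DERIV_continuous_on has_field_derivative_at_within)
  then show ?case
    using h[of 0] by (auto intro: continuous_on_compose2)
next
  case (Suc k)
  have "C_k k (\<lambda>y. D (Suc j) (h y) * partial_deriv i h y)" for i
    using Suc[of "Suc j"] h[of "Suc k"] by (auto intro!: C_k_mult)
  then have "C_k k (\<lambda>y. D (Suc j) (h y) * frechet_derivative h (at y) (axis i 1))" for i
    by (simp add: partial_deriv_def)
  moreover have "((\<lambda>y. D j (h y)) has_derivative
      (\<lambda>v. D (Suc j) (h y) * frechet_derivative h (at y) v)) (at y)" for y
    using has_derivative_compose[OF C_k_has_derivative[OF h[of "Suc 0"]] D[of j "h y", unfolded has_field_derivative_def]]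
    by simp
  ultimately show ?case
    by (intro C_k_SucI)
qed

section \<open>The flat function \<open>exp (- (1 / t))\<close> and the cutoffs built from
  it\<close>

text \<open>Differentiating \<open>poly p (1 / t) * exp (- (1 / t))\<close> in \<open>t\<close>
  replaces \<open>p\<close> by \<open>monom 1 2 * (p - pderiv p)\<close>; the factor
  \<open>monom 1 2\<close> comes from the inner derivative of \<open>1 / t\<close>.\<close>

primrec flat_exp_poly :: "nat \<Rightarrow> real poly" where
  "flat_exp_poly 0 = 1"
| "flat_exp_poly (Suc k) = monom 1 2 * (flat_exp_poly k - pderiv (flat_exp_poly k))"

text \<open>The \<open>k\<close>-th derivative of the smooth function that vanishes for \<open>t \<le> 0\<close> and equals \<open>exp (-1/t)\<close>
  for \<open>t > 0\<close>.\<close>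

definition flat_exp :: "nat \<Rightarrow> real \<Rightarrow> real" where
  "flat_exp k t = (if t \<le> 0 then 0 else poly (flat_exp_poly k) (1 / t) * exp (- (1 / t)))"

lemma tendsto_poly_mult_exp_neg: "((\<lambda>x::real. poly p x * exp (- x)) \<longlongrightarrow> 0) at_top"
proof -
  have "((\<lambda>x::real. \<Sum>i\<le>degree p. coeff p i * (x ^ i / exp x)) \<longlongrightarrow> (\<Sum>i\<le>degree p. coeff p i * 0)) at_top"
    by (intro tendsto_intros tendsto_power_div_exp_0)
  then show ?thesis
    by (simp add: poly_altdef exp_minus divide_inverse sum_distrib_right mult.assoc)
qed

text \<open>From the right the difference quotient is again a polynomial in \<open>1 / t\<close>
  times \<open>exp (- (1 / t))\<close>, with one more factor \<open>1 / t\<close> (hence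
  \<open>pCons 0\<close>), and the exponential wins as \<open>1 / t\<close> tends to infinity. From
  the left it is constantly 0.\<close>

lemma flat_exp_at_0: "(flat_exp k has_real_derivative flat_exp (Suc k) 0) (at 0)"
proof -
  have "((\<lambda>x. poly (pCons 0 (flat_exp_poly k)) (inverse x) * exp (- (inverse x))) \<longlongrightarrow> 0) (at_right (0::real))"
    by (rule filterlim_compose[OF tendsto_poly_mult_exp_neg filterlim_inverse_at_top_right])
  then have R: "((\<lambda>y. (flat_exp k y - flat_exp k 0) / (y - 0)) \<longlongrightarrow> 0) (at_right 0)"
    by (rule tendsto_cong[THEN iffD1, rotated])
       (auto simp: eventually_at_filter flat_exp_def field_simps)
  have L: "((\<lambda>y. (flat_exp k y - flat_exp k 0) / (y - 0)) \<longlongrightarrow> 0) (at_left 0)"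
    by (rule tendsto_eventually) (auto simp: eventually_at_filter flat_exp_def)
  show ?thesis
    using filterlim_split_at[OF L R] by (simp add: has_field_derivative_iff flat_exp_def)
qed

lemma flat_exp_has_derivative: "(flat_exp k has_real_derivative flat_exp (Suc k) t) (at t)"
proof (cases "t = 0")
  case True
  then show ?thesis using flat_exp_at_0 by simp
next
  case False
  then consider "t < 0" | "t > 0" by linarith
  then show ?thesis
  proof cases
    case 1
    have "((\<lambda>t. 0) has_real_derivative 0) (at t)" by simp
    then show ?thesis
      using 1
      by (subst has_field_derivative_cong_eventually[where g = "\<lambda>t. 0"])
         (auto simp: flat_exp_def eventually_at_filter intro: eventually_mono[OF eventually_nhds_in_open[of "{..<0}" t]])
  next
    case 2
    let ?p = "flat_exp_poly k"
    have "((\<lambda>t. poly ?p (1 / t) * exp (- (1 / t))) has_real_derivative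
        poly (pderiv ?p) (1 / t) * (- 1 / t\<^sup>2) * exp (- (1 / t))
         + poly ?p (1 / t) * (exp (- (1 / t)) * (1 / t\<^sup>2))) (at t)"
      using 2 by (auto intro!: derivative_eq_intros simp: power2_eq_square)
    moreover have "poly (pderiv ?p) (1 / t) * (- 1 / t\<^sup>2) * exp (- (1 / t))
         + poly ?p (1 / t) * (exp (- (1 / t)) * (1 / t\<^sup>2)) = flat_exp (Suc k) t"
      using 2 by (simp add: flat_exp_def poly_monom field_simps)
    ultimately have "((\<lambda>t. poly ?p (1 / t) * exp (- (1 / t))) has_real_derivative flat_exp (Suc k) t) (at t)"
      by simp
    then show ?thesis
      using 2
      by (subst has_field_derivative_cong_eventually[where g = "\<lambda>t. poly ?p (1 / t) * exp (- (1 / t))"])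
         (auto simp: flat_exp_def eventually_at_filter intro: eventually_mono[OF eventually_nhds_in_open[of "{0<..}" t]])
  qed
qed

lemma flat_exp_0: "flat_exp 0 t = (if t \<le> 0 then 0 else exp (- (1 / t)))"
  by (simp add: flat_exp_def)

text \<open>With \<open>\<phi> = flat_exp 0\<close> the cutoff is \<open>y \<mapsto> e \<phi>(1 - c \<phi>(|y - x|\<^sup>2 - a\<^sup>2))\<close>: composing \<open>\<phi>\<close> with itself
  avoids the usual quotient of bump functions, hence any differentiation of quotients.\<close>

lemma smooth_cutoff:
  fixes x :: "real^'d::finite"
  assumes "0 < a" "a < b"
  obtains g where "g \<in> Cc_infinity" "\<And>y. 0 \<le> g y" "\<And>y. g y \<le> 1"
    "\<And>y. y \<in> cball x a \<Longrightarrow> g y = 1" "\<And>y. y \<notin> ball x b \<Longrightarrow> g y = 0"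
proof -
  define s where "s = b\<^sup>2 - a\<^sup>2"
  have s: "s > 0" using assms by (simp add: s_def power_strict_mono)
  \<comment> \<open>Normalized so that \<open>c * flat_exp 0 s = 1\<close>, where \<open>s\<close>
    is the value of the inner argument on the sphere of radius \<open>b\<close>. Hence the outer
    argument \<open>f\<close> reaches 0 there and stays nonpositive further out.\<close>
  define c where "c = exp (1 / s)"
  define f where "f = (\<lambda>y. 1 + (- c) * flat_exp 0 ((y - x) \<bullet> (y - x) + - a\<^sup>2))"
  define g where "g = (\<lambda>y. exp 1 * flat_exp 0 (f y))"
  have "C_k k f" for k
    unfolding f_def
    by (intro C_k_add C_k_mult C_k_const C_k_compose[of flat_exp] C_k_norm_square flat_exp_has_derivative)
  then have smooth: "C_k k g" for k
    unfolding g_def by (intro C_k_mult C_k_const C_k_compose[of flat_exp] flat_exp_has_derivative)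
  have f_le: "f y \<le> 1" for y
    by (simp add: f_def flat_exp_0 c_def)
  have zero: "g y = 0" if "y \<notin> ball x b" for y
  proof -
    have "b\<^sup>2 \<le> (norm (y - x))\<^sup>2"
      using that assms by (intro power_mono) (auto simp: dist_norm norm_minus_commute)
    then have t: "s \<le> (y - x) \<bullet> (y - x) + - a\<^sup>2"
      by (simp add: s_def power2_norm_eq_inner)
    then have "1 / ((y - x) \<bullet> (y - x) + - a\<^sup>2) \<le> 1 / s"
      using s by (intro divide_left_mono) auto
    then have "1 \<le> exp (1 / s - 1 / ((y - x) \<bullet> (y - x) + - a\<^sup>2))"
      by simp
    then have "f y \<le> 0"
      using t s by (simp add: f_def flat_exp_0 c_def exp_diff exp_minus divide_inverse)
    then show ?thesis by (simp add: g_def flat_exp_0)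
  qed
  show ?thesis
  proof
    have "{y. g y \<noteq> 0} \<subseteq> cball x b"
      using zero by force
    then have "bounded {y. g y \<noteq> 0}"
      using bounded_cball bounded_subset by blast
    then show "g \<in> Cc_infinity"
      using smooth by (simp add: Cc_infinity_def)
    show "0 \<le> g y" for y
      by (simp add: g_def flat_exp_0)
    show "g y \<le> 1" for y
    proof (cases "f y \<le> 0")
      case False
      then have "1 / f y \<ge> 1" using f_le[of y] by simp
      then have "exp (1 - 1 / f y) \<le> 1" by simp
      then show ?thesis
        using False by (simp add: g_def flat_exp_0 exp_diff exp_minus divide_inverse)
    qed (simp add: g_def flat_exp_0)
    show "g y = 1" if "y \<in> cball x a" for y
    proof -
      have "(norm (y - x))\<^sup>2 \<le> a\<^sup>2"
        using that assms by (intro power_mono) (auto simp: dist_norm norm_minus_commute)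
      then have "f y = 1"
        by (simp add: f_def flat_exp_0 power2_norm_eq_inner)
      then show ?thesis
        by (simp add: g_def flat_exp_0 exp_minus)
    qed
    show "g y = 0" if "y \<notin> ball x b" for y
      using zero[OF that] .
  qed
qed

text \<open>Makes the local part of the operator vanish where a cutoff is constant. For second
  derivatives it is applied to a first partial derivative, which is constantly 0 nearby.\<close>

lemma partial_deriv_locally_const:
  assumes "open U" "z \<in> U" "\<And>w. w \<in> U \<Longrightarrow> g w = c"
  shows "partial_deriv i g z = 0"
proof -
  have "((\<lambda>w. c) has_derivative (\<lambda>h. 0)) (at z)" by simp
  then have "(g has_derivative (\<lambda>h. 0)) (at z)"
    by (rule has_derivative_transform_within_open[OF _ assms(1,2)]) (simp add: assms(3))
  then show ?thesis by (simp add: partial_deriv_has_derivative)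
qed

section \<open>Optional stopping at finitely many times\<close>

text \<open>Stopped values of a martingale at bounded random times need not be bounded. The weights
  below make them bounded without spoiling the optional stopping identity; this replaces the
  uniform integrability of the stopped values when passing to the limit.\<close>

definition damp :: "nat \<Rightarrow> real \<Rightarrow> real" where
  "damp k v = real (Suc k) / (real (Suc k) + \<bar>v\<bar>)"

lemma damp_nonneg: "0 \<le> damp k v"
  by (simp add: damp_def)

lemma damp_le_1: "damp k v \<le> 1"
  by (simp add: damp_def)

lemma abs_mult_damp_le: "\<bar>v * damp k v\<bar> \<le> real (Suc k)"
proof -
  have "\<bar>v\<bar> * real (Suc k) \<le> real (Suc k) * (real (Suc k) + \<bar>v\<bar>)"
    by (simp add: algebra_simps)
  then show ?thesis
    by (simp add: damp_def abs_mult divide_le_eq)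
qed

text \<open>Damping moves a value towards 0, so the lower bound survives. It keeps the integrands
  nonnegative when Fatou's lemma is applied after adding 1.\<close>

lemma mult_damp_ge: "- 1 \<le> v \<Longrightarrow> - 1 \<le> v * damp k v"
proof (cases "v \<ge> 0")
  case True
  then show ?thesis using damp_nonneg[of k v] by (smt (verit) mult_nonneg_nonneg)
next
  case False
  assume "- 1 \<le> v"
  then have "v * 1 \<le> v * damp k v"
    using False damp_le_1 by (intro mult_left_mono_neg) auto
  then show ?thesis using \<open>- 1 \<le> v\<close> by simp
qed

lemma continuous_damp: "continuous_on UNIV (damp k)"
  unfolding damp_def by (intro continuous_intros) (auto simp: add_nonneg_eq_0_iff)

lemma borel_measurable_damp [measurable]: "damp k \<in> borel_measurable borel"
  by (intro borel_measurable_continuous_onI continuous_damp)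

lemma tendsto_damp: "(\<lambda>k. damp k v) \<longlonglongrightarrow> 1"
proof -
  have "(\<lambda>k. inverse (1 + \<bar>v\<bar> / real (Suc k))) \<longlonglongrightarrow> inverse (1 + 0)"
    by (intro tendsto_intros LIMSEQ_Suc[OF lim_const_over_n]) auto
  moreover have "inverse (1 + \<bar>v\<bar> / real (Suc k)) = damp k v" for k
    by (simp add: damp_def field_simps)
  ultimately show ?thesis by simp
qed

text \<open>On \<open>{T = v}\<close> the weight is \<open>damp k (Y v)\<close>, which is bounded
  and measurable at time \<open>v\<close>. So the martingale identity between \<open>v\<close> and
  \<open>u\<close> can be tested against it, and summing over the finitely many values
  \<open>v\<close> gives the claim.\<close>

lemma (in prob_space) martingale_damped_stopping:
  assumes sub: "\<And>s. subalgebra M (F s)"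
    and mart: "martingale M F Y"
    and S: "finite S" "S \<subseteq> {0..u}"
    and T: "\<And>\<omega>. \<omega> \<in> space M \<Longrightarrow> T \<omega> \<in> S"
    and T_le: "\<And>v. v \<in> S \<Longrightarrow> {\<omega> \<in> space M. T \<omega> \<le> v} \<in> sets (F (ennreal v))"
    and mono: "\<And>v w. v \<in> S \<Longrightarrow> w \<in> S \<Longrightarrow> v \<le> w \<Longrightarrow> sets (F (ennreal v)) \<subseteq> sets (F (ennreal w))"
  shows "(\<lambda>\<omega>. Y (T \<omega>) \<omega>) \<in> borel_measurable M" (is ?meas)
    and "(\<integral>\<omega>. Y (T \<omega>) \<omega> * damp k (Y (T \<omega>) \<omega>) \<partial>M) = (\<integral>\<omega>. Y u \<omega> * damp k (Y (T \<omega>) \<omega>) \<partial>M)" (is ?eq)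
proof -
  let ?A = "\<lambda>v. {\<omega> \<in> space M. T \<omega> = v}"
  have A_F: "?A v \<in> sets (F (ennreal v))" if "v \<in> S" for v
  proof -
    \<comment> \<open>As \<open>T\<close> takes values in the finite set \<open>S\<close>, removing
      the events for the smaller elements of \<open>S\<close> leaves exactly
      \<open>{T = v}\<close>.\<close>
    have "?A v = {\<omega> \<in> space M. T \<omega> \<le> v} - (\<Union>w\<in>{w\<in>S. w < v}. {\<omega> \<in> space M. T \<omega> \<le> w})"
    proof (intro set_eqI iffI)
      fix \<omega>
      assume \<omega>: "\<omega> \<in> {\<omega> \<in> space M. T \<omega> \<le> v} - (\<Union>w\<in>{w\<in>S. w < v}. {\<omega> \<in> space M. T \<omega> \<le> w})"
      then have "\<not> T \<omega> < v" using T[of \<omega>] by blast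
      then show "\<omega> \<in> ?A v" using \<omega> by auto
    qed auto
    also have "\<dots> \<in> sets (F (ennreal v))"
    proof (intro sets.Diff sets.finite_UN T_le that)
      show "{\<omega> \<in> space M. T \<omega> \<le> w} \<in> sets (F (ennreal v))" if "w \<in> {w \<in> S. w < v}" for w
        using that \<open>v \<in> S\<close> T_le[of w] mono[of w v] by auto
    qed (use S in auto)
    finally show ?thesis .
  qed
  have A_M: "?A v \<in> sets M" if "v \<in> S" for v
    using A_F[OF that] sub by (auto simp: subalgebra_def)
  have Y_F: "Y v \<in> borel_measurable (F (ennreal v))" and Y_int: "integrable M (Y v)" if "0 \<le> v" for v
    using mart that by (auto simp: martingale_def)
  have Y_M[measurable]: "Y v \<in> borel_measurable M" if "v \<in> S" for v
    using that S Y_int by auto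
  \<comment> \<open>Splitting by the value of \<open>T\<close> turns each stopped quantity into a
    finite sum over deterministic times.\<close>
  have T_sum: "h (T \<omega>) \<omega> = (\<Sum>v\<in>S. indicator (?A v) \<omega> * h v \<omega>)" if "\<omega> \<in> space M" for \<omega> and h :: "real \<Rightarrow> 'a \<Rightarrow> real"
  proof -
    have "(\<Sum>v\<in>S. indicator (?A v) \<omega> * h v \<omega>) = (\<Sum>v\<in>S. if v = T \<omega> then h v \<omega> else 0)"
      using that by (intro sum.cong) (auto simp: indicator_def)
    then show ?thesis using T[OF that] S by simp
  qed
  have "(\<lambda>\<omega>. \<Sum>v\<in>S. indicator (?A v) \<omega> * Y v \<omega>) \<in> borel_measurable M"
    using A_M by (intro borel_measurable_sum borel_measurable_times borel_measurable_indicator Y_M) auto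
  then show ?meas
    by (rule measurable_cong[THEN iffD2, rotated]) (rule T_sum)
  have int: "integrable M (\<lambda>\<omega>. indicator (?A v) \<omega> * (Z \<omega> * damp k (Y v \<omega>)))"
    if "v \<in> S" "integrable M Z" for v Z
  proof (rule Bochner_Integration.integrable_bound[OF that(2)])
    show "(\<lambda>\<omega>. indicator (?A v) \<omega> * (Z \<omega> * damp k (Y v \<omega>))) \<in> borel_measurable M"
      using that A_M Y_M by (auto intro!: borel_measurable_times borel_measurable_indicator)
    have "\<bar>damp k (Y v \<omega>)\<bar> \<le> 1" for \<omega>
      using damp_nonneg damp_le_1 by (simp add: abs_of_nonneg)
    then show "AE \<omega> in M. norm (indicator (?A v) \<omega> * (Z \<omega> * damp k (Y v \<omega>))) \<le> norm (Z \<omega>)"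
      by (auto simp: abs_mult indicator_def intro!: mult_left_le)
  qed
  have step: "(\<integral>\<omega>. indicator (?A v) \<omega> * (Y v \<omega> * damp k (Y v \<omega>)) \<partial>M)
      = (\<integral>\<omega>. indicator (?A v) \<omega> * (Y u \<omega> * damp k (Y v \<omega>)) \<partial>M)" if v: "v \<in> S" for v
  proof -
    interpret finite_measure_subalgebra M "F (ennreal v)"
      by standard (rule sub)
    have vu: "0 \<le> v" "v \<le> u" using v S by auto
    define f where "f = (\<lambda>\<omega>. indicator (?A v) \<omega> * damp k (Y v \<omega>))"
    have f[measurable]: "f \<in> borel_measurable (F (ennreal v))"
      unfolding f_def using A_F[OF v] Y_F[OF vu(1)] by (auto intro!: borel_measurable_times borel_measurable_indicator)
    have "integrable M (\<lambda>\<omega>. f \<omega> * Y u \<omega>)"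
      using int[OF v Y_int[of u]] vu by (simp add: f_def mult_ac)
    then have "(\<integral>\<omega>. f \<omega> * Y u \<omega> \<partial>M) = (\<integral>\<omega>. f \<omega> * real_cond_exp M (F (ennreal v)) (Y u) \<omega> \<partial>M)"
      using Y_int[of u] vu f by (subst real_cond_exp_intg(2)) auto
    also have "\<dots> = (\<integral>\<omega>. f \<omega> * Y v \<omega> \<partial>M)"
    proof (rule integral_cong_AE)
      show "(\<lambda>\<omega>. f \<omega> * real_cond_exp M (F (ennreal v)) (Y u) \<omega>) \<in> borel_measurable M"
        using measurable_from_subalg[OF sub f] by measurable
      show "(\<lambda>\<omega>. f \<omega> * Y v \<omega>) \<in> borel_measurable M"
        using measurable_from_subalg[OF sub f] Y_M[OF v] by measurable
      have "AE \<omega> in M. real_cond_exp M (F (ennreal v)) (Y u) \<omega> = Y v \<omega>"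
        using mart vu by (auto simp: martingale_def)
      then show "AE \<omega> in M. f \<omega> * real_cond_exp M (F (ennreal v)) (Y u) \<omega> = f \<omega> * Y v \<omega>"
        by eventually_elim simp
    qed
    finally show ?thesis by (simp add: f_def mult_ac)
  qed
  have "(\<integral>\<omega>. Y (T \<omega>) \<omega> * damp k (Y (T \<omega>) \<omega>) \<partial>M)
      = (\<integral>\<omega>. (\<Sum>v\<in>S. indicator (?A v) \<omega> * (Y v \<omega> * damp k (Y v \<omega>))) \<partial>M)"
    by (intro Bochner_Integration.integral_cong refl T_sum[of _ "\<lambda>v \<omega>. Y v \<omega> * damp k (Y v \<omega>)"])
  also have "\<dots> = (\<Sum>v\<in>S. (\<integral>\<omega>. indicator (?A v) \<omega> * (Y v \<omega> * damp k (Y v \<omega>)) \<partial>M))"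
    using S Y_int by (intro Bochner_Integration.integral_sum int) auto
  also have "\<dots> = (\<Sum>v\<in>S. (\<integral>\<omega>. indicator (?A v) \<omega> * (Y u \<omega> * damp k (Y v \<omega>)) \<partial>M))"
    by (intro sum.cong refl step)
  also have "\<dots> = (\<integral>\<omega>. (\<Sum>v\<in>S. indicator (?A v) \<omega> * (Y u \<omega> * damp k (Y v \<omega>))) \<partial>M)"
  proof (intro Bochner_Integration.integral_sum[symmetric] int)
    show "integrable M (Y u)" if "v \<in> S" for v
      using that S by (intro Y_int) auto
  qed
  also have "\<dots> = (\<integral>\<omega>. Y u \<omega> * damp k (Y (T \<omega>) \<omega>) \<partial>M)"
    by (intro Bochner_Integration.integral_cong refl T_sum[of _ "\<lambda>v \<omega>. Y u \<omega> * damp k (Y v \<omega>)", symmetric])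
  finally show ?eq .
qed

text \<open>Two limits in turn. For fixed \<open>k\<close>, let \<open>n\<close> tend to infinity by
  dominated convergence, with \<open>real (Suc k)\<close> dominating on the left and
  \<open>\<bar>Z \<omega>\<bar>\<close> on the right. Then let \<open>k\<close> tend to infinity:
  Fatou's lemma on the left, where \<open>N' + 1\<close> is nonnegative, and dominated convergence
  on the right.\<close>

lemma (in prob_space) nn_integral_damped_limit_le:
  assumes Z: "integrable M Z"
    and N_meas[measurable]: "\<And>n. N n \<in> borel_measurable M" "N' \<in> borel_measurable M"
    and lim: "AE \<omega> in M. (\<lambda>n. N n \<omega>) \<longlonglongrightarrow> N' \<omega>"
    and eq: "\<And>k n. (\<integral>\<omega>. N n \<omega> * damp k (N n \<omega>) \<partial>M) = (\<integral>\<omega>. Z \<omega> * damp k (N n \<omega>) \<partial>M)"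
    and ge: "AE \<omega> in M. - 1 \<le> N' \<omega>"
  shows "(\<integral>\<^sup>+\<omega>. ennreal (N' \<omega> + 1) \<partial>M) \<le> ennreal ((\<integral>\<omega>. Z \<omega> \<partial>M) + 1)"
proof -
  have [measurable]: "Z \<in> borel_measurable M" using Z by auto
  have abs_damp: "\<bar>damp k v\<bar> \<le> 1" for k v
    using damp_nonneg damp_le_1 by (simp add: abs_of_nonneg)
  have damp_cont: "isCont (damp k) v" for k v
    using continuous_damp by (simp add: continuous_on_eq_continuous_at)
  have eq': "(\<integral>\<omega>. N' \<omega> * damp k (N' \<omega>) \<partial>M) = (\<integral>\<omega>. Z \<omega> * damp k (N' \<omega>) \<partial>M)" for k
  proof (rule LIMSEQ_unique)
    show "(\<lambda>n. \<integral>\<omega>. N n \<omega> * damp k (N n \<omega>) \<partial>M) \<longlonglongrightarrow> (\<integral>\<omega>. N' \<omega> * damp k (N' \<omega>) \<partial>M)"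
    proof (rule integral_dominated_convergence[where w = "\<lambda>_. real (Suc k)"])
      show "AE \<omega> in M. (\<lambda>n. N n \<omega> * damp k (N n \<omega>)) \<longlonglongrightarrow> N' \<omega> * damp k (N' \<omega>)"
        using lim by eventually_elim (auto intro!: tendsto_intros isCont_tendsto_compose[OF damp_cont])
      show "\<And>n. AE \<omega> in M. norm (N n \<omega> * damp k (N n \<omega>)) \<le> real (Suc k)"
        using abs_mult_damp_le by simp
    qed auto
    show "(\<lambda>n. \<integral>\<omega>. N n \<omega> * damp k (N n \<omega>) \<partial>M) \<longlonglongrightarrow> (\<integral>\<omega>. Z \<omega> * damp k (N' \<omega>) \<partial>M)"
      unfolding eq
    proof (rule integral_dominated_convergence[where w = "\<lambda>\<omega>. \<bar>Z \<omega>\<bar>"])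
      show "AE \<omega> in M. (\<lambda>n. Z \<omega> * damp k (N n \<omega>)) \<longlonglongrightarrow> Z \<omega> * damp k (N' \<omega>)"
        using lim by eventually_elim (auto intro!: tendsto_intros isCont_tendsto_compose[OF damp_cont])
      show "\<And>n. AE \<omega> in M. norm (Z \<omega> * damp k (N n \<omega>)) \<le> \<bar>Z \<omega>\<bar>"
        using abs_damp by (auto simp: abs_mult intro!: mult_left_le)
    qed (use Z in auto)
  qed
  have lim_Z: "(\<lambda>k. \<integral>\<omega>. Z \<omega> * damp k (N' \<omega>) \<partial>M) \<longlonglongrightarrow> (\<integral>\<omega>. Z \<omega> * 1 \<partial>M)"
  proof (rule integral_dominated_convergence[where w = "\<lambda>\<omega>. \<bar>Z \<omega>\<bar>"])
    show "AE \<omega> in M. (\<lambda>k. Z \<omega> * damp k (N' \<omega>)) \<longlonglongrightarrow> Z \<omega> * 1"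
      by (intro AE_I2 tendsto_intros tendsto_damp)
    show "\<And>k. AE \<omega> in M. norm (Z \<omega> * damp k (N' \<omega>)) \<le> \<bar>Z \<omega>\<bar>"
      using abs_damp by (auto simp: abs_mult intro!: mult_left_le)
  qed (use Z in auto)
  have int: "integrable M (\<lambda>\<omega>. N' \<omega> * damp k (N' \<omega>))" for k
    using abs_mult_damp_le by (intro integrable_const_bound[where B = "real (Suc k)"]) auto
  have "(\<integral>\<^sup>+\<omega>. ennreal (N' \<omega> + 1) \<partial>M) = (\<integral>\<^sup>+\<omega>. liminf (\<lambda>k. ennreal (N' \<omega> * damp k (N' \<omega>) + 1)) \<partial>M)"
  proof (intro nn_integral_cong)
    fix \<omega>
    have "(\<lambda>k. ennreal (N' \<omega> * damp k (N' \<omega>) + 1)) \<longlonglongrightarrow> ennreal (N' \<omega> * 1 + 1)"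
      by (intro tendsto_intros tendsto_damp)
    then show "ennreal (N' \<omega> + 1) = liminf (\<lambda>k. ennreal (N' \<omega> * damp k (N' \<omega>) + 1))"
      by (simp add: lim_imp_Liminf)
  qed
  also have "\<dots> \<le> liminf (\<lambda>k. \<integral>\<^sup>+\<omega>. ennreal (N' \<omega> * damp k (N' \<omega>) + 1) \<partial>M)"
    by (rule nn_integral_liminf) auto
  also have "\<dots> = liminf (\<lambda>k. ennreal ((\<integral>\<omega>. Z \<omega> * damp k (N' \<omega>) \<partial>M) + 1))"
  proof -
    have "(\<integral>\<^sup>+\<omega>. ennreal (N' \<omega> * damp k (N' \<omega>) + 1) \<partial>M) = ennreal (\<integral>\<omega>. N' \<omega> * damp k (N' \<omega>) + 1 \<partial>M)" for k
    proof (rule nn_integral_eq_integral)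
      show "AE \<omega> in M. 0 \<le> N' \<omega> * damp k (N' \<omega>) + 1"
        using ge
      proof eventually_elim
        case (elim \<omega>)
        then show ?case using mult_damp_ge[of "N' \<omega>" k] by linarith
      qed
    qed (use int in auto)
    then show ?thesis
      using int by (simp add: eq'[symmetric] prob_space)
  qed
  also have "\<dots> = ennreal ((\<integral>\<omega>. Z \<omega> \<partial>M) + 1)"
    using lim_Z by (intro lim_imp_Liminf) (auto intro!: tendsto_intros)
  finally show ?thesis .
qed

section \<open>Leaving a closed set\<close>

lemma space_natural_filtration [simp]: "space (natural_filtration \<Omega> X t) = \<Omega>"
  by (simp add: natural_filtration_def space_measure_of_conv)

lemma sets_natural_filtration:
  "sets (natural_filtration \<Omega> X t) =
    sigma_sets \<Omega> {X s -` B \<inter> \<Omega> | s B. 0 \<le> s \<and> ennreal s \<le> t \<and> B \<in> sets borel}"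
  unfolding natural_filtration_def by (rule sets_measure_of) auto

lemma natural_filtration_sets:
  "0 \<le> s \<Longrightarrow> ennreal s \<le> t \<Longrightarrow> B \<in> sets borel \<Longrightarrow> X s -` B \<inter> \<Omega> \<in> sets (natural_filtration \<Omega> X t)"
  by (auto simp: sets_natural_filtration)

lemma natural_filtration_mono:
  "s \<le> t \<Longrightarrow> sets (natural_filtration \<Omega> X s) \<subseteq> sets (natural_filtration \<Omega> X t)"
  unfolding sets_natural_filtration by (intro sigma_sets_mono') (auto dest: order_trans)

lemma subalgebra_natural_filtration:
  assumes "\<And>s. 0 \<le> s \<Longrightarrow> X s \<in> measurable M borel"
  shows "subalgebra M (natural_filtration (space M) X t)"
  unfolding subalgebra_def sets_natural_filtration
  using assms by (auto intro!: sets.sigma_sets_subset dest: measurable_sets)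

text \<open>Right continuity keeps the path in \<open>U\<close> shortly after \<open>s\<close>. This
  reduces statements about all times to countably many times.\<close>

lemma cadlag_rational_witness:
  fixes f :: "real \<Rightarrow> 'e::topological_space"
  assumes "cadlag f" "open U" "0 \<le> s" "s < a" "f s \<in> U"
  obtains q where "q \<in> \<rat>" "s < q" "q < a" "f q \<in> U"
proof -
  have "eventually (\<lambda>v. f v \<in> U) (at_right s)"
    using assms by (auto simp: cadlag_def intro: topological_tendstoD)
  then obtain c where c: "c > s" "\<And>v. s < v \<Longrightarrow> v < c \<Longrightarrow> f v \<in> U"
    by (auto simp: eventually_at_right_field)
  then obtain q where "q \<in> \<rat>" "s < q" "q < min a c"
    using Rats_dense_in_real[of s "min a c"] assms by auto
  then show ?thesis using c that by auto
qed

text \<open>Inserting \<open>u\<close> caps the time at \<open>u\<close> and keeps the infimum away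
  from the empty set, so the time is a finite real.\<close>

definition leave_time :: "(real \<Rightarrow> 'w \<Rightarrow> 'e) \<Rightarrow> 'e set \<Rightarrow> real \<Rightarrow> 'w \<Rightarrow> real" where
  "leave_time X C u \<omega> = Inf (insert u {s. 0 \<le> s \<and> s \<le> u \<and> X s \<omega> \<notin> C})"

text \<open>With \<open>a \<le> u\<close> the inserted point \<open>u\<close> is never a witness for
  being below \<open>a\<close>, so a witness must be a time outside \<open>C\<close>.\<close>

lemma leave_time_less_iff:
  assumes "0 \<le> u" "a \<le> u"
  shows "leave_time X C u \<omega> < a \<longleftrightarrow> (\<exists>s. 0 \<le> s \<and> s < a \<and> X s \<omega> \<notin> C)"
proof -
  have "bdd_below (insert u {s. 0 \<le> s \<and> s \<le> u \<and> X s \<omega> \<notin> C})"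
    using assms by (auto intro!: bdd_belowI[of _ 0])
  then show ?thesis
    using assms unfolding leave_time_def by (subst cInf_less_iff) auto
qed

lemma leave_time_bounds:
  assumes "0 \<le> u"
  shows "0 \<le> leave_time X C u \<omega>" "leave_time X C u \<omega> \<le> u"
  unfolding leave_time_def using assms
  by (auto intro!: cInf_greatest cInf_lower bdd_belowI[of _ 0])

lemma before_leave_time:
  assumes "0 \<le> s" "s < leave_time X C u \<omega>" "0 \<le> u"
  shows "X s \<omega> \<in> C"
  using assms leave_time_bounds(2)[of u X C \<omega>] leave_time_less_iff[of u "leave_time X C u \<omega>" X C \<omega>] by auto

text \<open>The complement of \<open>C\<close> is open, so a visit to it before \<open>a\<close> can
  be witnessed at a rational time before \<open>a\<close>. The event is a countable union of events
  observed at times below \<open>a \<le> v\<close>.\<close>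

lemma sets_leave_time_less:
  fixes X :: "real \<Rightarrow> 'w \<Rightarrow> 'e::topological_space"
  assumes "\<And>\<omega>. \<omega> \<in> \<Omega> \<Longrightarrow> cadlag (\<lambda>t. X t \<omega>)" "closed C" "0 \<le> u" "a \<le> u" "a \<le> v"
  shows "{\<omega> \<in> \<Omega>. leave_time X C u \<omega> < a} \<in> sets (natural_filtration \<Omega> X (ennreal v))"
proof -
  have "{\<omega> \<in> \<Omega>. leave_time X C u \<omega> < a} = (\<Union>q\<in>{q\<in>\<rat>. 0 \<le> q \<and> q < a}. X q -` (- C) \<inter> \<Omega>)"
  proof (intro set_eqI iffI)
    fix \<omega> assume "\<omega> \<in> {\<omega> \<in> \<Omega>. leave_time X C u \<omega> < a}"
    then obtain s where \<omega>: "\<omega> \<in> \<Omega>" and s: "0 \<le> s" "s < a" "X s \<omega> \<notin> C"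
      using assms by (auto simp: leave_time_less_iff)
    obtain q where "q \<in> \<rat>" "s < q" "q < a" "X q \<omega> \<in> - C"
      using cadlag_rational_witness[OF assms(1)[OF \<omega>], of "- C" s a] assms(2) s by auto
    then show "\<omega> \<in> (\<Union>q\<in>{q\<in>\<rat>. 0 \<le> q \<and> q < a}. X q -` (- C) \<inter> \<Omega>)"
      using \<omega> s by (auto intro!: bexI[of _ q])
  qed (use assms in \<open>auto simp: leave_time_less_iff\<close>)
  also have "\<dots> \<in> sets (natural_filtration \<Omega> X (ennreal v))"
  proof (intro sets.countable_UN'')
    show "countable {q \<in> \<rat>. 0 \<le> q \<and> q < a}"
      by (rule countable_subset[OF _ countable_rat]) auto
    show "X q -` (- C) \<inter> \<Omega> \<in> sets (natural_filtration \<Omega> X (ennreal v))"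
      if "q \<in> {q \<in> \<rat>. 0 \<le> q \<and> q < a}" for q
      using that assms by (intro natural_filtration_sets) (auto intro!: ennreal_leI)
  qed
  finally show ?thesis .
qed

definition stay :: "'w set \<Rightarrow> (real \<Rightarrow> 'w \<Rightarrow> 'e) \<Rightarrow> 'e set \<Rightarrow> real \<Rightarrow> 'w set" where
  "stay \<Omega> X C u = {\<omega> \<in> \<Omega>. \<forall>s. 0 \<le> s \<longrightarrow> s \<le> u \<longrightarrow> X s \<omega> \<in> C}"

lemma leave_time_stay: "\<omega> \<in> stay \<Omega> X C u \<Longrightarrow> leave_time X C u \<omega> = u"
proof -
  assume "\<omega> \<in> stay \<Omega> X C u"
  then have "insert u {s. 0 \<le> s \<and> s \<le> u \<and> X s \<omega> \<notin> C} = {u}"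
    by (auto simp: stay_def)
  then show ?thesis unfolding leave_time_def by (simp only: cInf_singleton)
qed

text \<open>The final time is treated separately: a position outside \<open>C\<close> exactly at
  \<open>u\<close> need not have a rational witness within \<open>[0, u]\<close>.\<close>

lemma sets_stay:
  fixes X :: "real \<Rightarrow> 'w \<Rightarrow> 'e::topological_space"
  assumes X: "\<And>s. 0 \<le> s \<Longrightarrow> X s \<in> measurable M borel"
    and "\<And>\<omega>. \<omega> \<in> space M \<Longrightarrow> cadlag (\<lambda>t. X t \<omega>)" "closed C" "0 \<le> u"
  shows "stay (space M) X C u \<in> sets M"
proof -
  have "stay (space M) X C u = (X u -` C \<inter> space M) - {\<omega> \<in> space M. leave_time X C u \<omega> < u}"
    using assms(4) by (auto simp: stay_def leave_time_less_iff le_less)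
  moreover have "{\<omega> \<in> space M. leave_time X C u \<omega> < u} \<in> sets M"
    using sets_leave_time_less[of "space M" X C u u u] subalgebra_natural_filtration[of X M "ennreal u"] assms
    by (auto simp: subalgebra_def)
  moreover have "X u -` C \<inter> space M \<in> sets M"
    using X[OF assms(4)] assms(3) by (auto intro: measurable_sets)
  ultimately show ?thesis by auto
qed

section \<open>Discretization of the leaving time from above\<close>

text \<open>Rounding strictly upwards makes \<open>{grid_time \<le> v}\<close> an event of the form \<open>{leave_time < a}\<close> with
  \<open>a \<le> v\<close>. Such events lie in the natural filtration, which need not be right continuous.\<close>

definition grid_time :: "nat \<Rightarrow> real \<Rightarrow> real \<Rightarrow> real" where
  "grid_time n u a = min u ((real_of_int \<lfloor>real (Suc n) * a\<rfloor> + 1) / real (Suc n))"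

lemma grid_time_bounds:
  assumes "a \<le> u"
  shows "a \<le> grid_time n u a" "grid_time n u a \<le> u" "grid_time n u a \<le> a + inverse (real (Suc n))"
proof -
  have "real (Suc n) * a \<le> real_of_int \<lfloor>real (Suc n) * a\<rfloor> + 1"
    by linarith
  then have "a \<le> (real_of_int \<lfloor>real (Suc n) * a\<rfloor> + 1) / real (Suc n)"
    by (simp add: le_divide_eq mult.commute del: of_nat_Suc)
  then show "a \<le> grid_time n u a" using assms by (simp add: grid_time_def del: of_nat_Suc)
  have "real_of_int \<lfloor>real (Suc n) * a\<rfloor> + 1 \<le> real (Suc n) * a + 1"
    by linarith
  then have "(real_of_int \<lfloor>real (Suc n) * a\<rfloor> + 1) / real (Suc n) \<le> (real (Suc n) * a + 1) / real (Suc n)"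
    by (intro divide_right_mono) auto
  also have "\<dots> = a + inverse (real (Suc n))"
    by (simp add: add_divide_distrib inverse_eq_divide del: of_nat_Suc)
  finally show "grid_time n u a \<le> a + inverse (real (Suc n))"
    by (simp add: grid_time_def del: of_nat_Suc)
qed (simp add: grid_time_def)

lemma tendsto_grid_time:
  assumes "a \<le> u"
  shows "(\<lambda>n. grid_time n u a) \<longlonglongrightarrow> a"
proof (rule tendsto_sandwich[OF _ _ tendsto_const])
  show "(\<lambda>n. a + inverse (real (Suc n))) \<longlonglongrightarrow> a"
    using tendsto_add[OF tendsto_const LIMSEQ_inverse_real_of_nat] by simp
qed (use assms grid_time_bounds in auto)

lemma finite_grid_time: "finite (grid_time n u ` {0..u})"
proof (rule finite_subset)
  have "\<lfloor>real (Suc n) * a\<rfloor> \<in> {0..\<lfloor>real (Suc n) * u\<rfloor>}" if "a \<in> {0..u}" for a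
    using that by (auto intro!: floor_mono mult_left_mono simp del: of_nat_Suc)
  then show "grid_time n u ` {0..u} \<subseteq>
      (\<lambda>k. min u ((real_of_int k + 1) / real (Suc n))) ` {0..\<lfloor>real (Suc n) * u\<rfloor>}"
    unfolding grid_time_def by (auto simp del: of_nat_Suc)
qed auto

text \<open>Below \<open>u\<close> the cap is inactive, and the condition compares integers:
  \<open>k + 1 \<le> y\<close> for an integer \<open>k\<close> means
  \<open>k < \<lfloor>y\<rfloor>\<close>.\<close>

lemma grid_time_le_iff:
  assumes "v < u"
  shows "grid_time n u a \<le> v \<longleftrightarrow> a < real_of_int \<lfloor>real (Suc n) * v\<rfloor> / real (Suc n)"
proof -
  have "grid_time n u a \<le> v \<longleftrightarrow> real_of_int (\<lfloor>real (Suc n) * a\<rfloor> + 1) \<le> real (Suc n) * v"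
    using assms by (simp add: grid_time_def min_le_iff_disj divide_le_eq mult.commute del: of_nat_Suc)
  also have "\<dots> \<longleftrightarrow> \<lfloor>real (Suc n) * a\<rfloor> < \<lfloor>real (Suc n) * v\<rfloor>"
    by (simp only: le_floor_iff[symmetric]) linarith
  also have "\<dots> \<longleftrightarrow> a < real_of_int \<lfloor>real (Suc n) * v\<rfloor> / real (Suc n)"
    by (simp add: floor_less_iff less_divide_eq mult.commute del: of_nat_Suc)
  finally show ?thesis .
qed

lemma sets_grid_leave_time:
  fixes X :: "real \<Rightarrow> 'w \<Rightarrow> 'e::topological_space"
  assumes "\<And>\<omega>. \<omega> \<in> \<Omega> \<Longrightarrow> cadlag (\<lambda>t. X t \<omega>)" "closed C" "0 \<le> u"
  shows "{\<omega> \<in> \<Omega>. grid_time n u (leave_time X C u \<omega>) \<le> v} \<in> sets (natural_filtration \<Omega> X (ennreal v))"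
proof (cases "v < u")
  case True
  \<comment> \<open>The threshold for the leaving time is at most \<open>v\<close>, so the event is
    known at time \<open>v\<close>.\<close>
  have "real_of_int \<lfloor>real (Suc n) * v\<rfloor> / real (Suc n) \<le> v"
    by (simp add: divide_le_eq mult.commute del: of_nat_Suc)
  then show ?thesis
    using True assms by (simp add: grid_time_le_iff sets_leave_time_less del: of_nat_Suc)
next
  case False
  then have "grid_time n u (leave_time X C u \<omega>) \<le> v" for \<omega>
    using grid_time_bounds(2)[OF leave_time_bounds(2)[OF assms(3)], of n X C \<omega>] by linarith
  then have "{\<omega> \<in> \<Omega>. grid_time n u (leave_time X C u \<omega>) \<le> v} = \<Omega>"
    by simp
  then show ?thesis
    using sets.top[of "natural_filtration \<Omega> X (ennreal v)"] by simp
qed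

section \<open>Passage to the limit in the stopped martingale identity\<close>

text \<open>Since \<open>T n\<close> approaches \<open>a\<close> from the right, the indicators of
  \<open>{0..T n}\<close> converge at every point, including \<open>a\<close> itself, and dominated
  convergence applies.\<close>

lemma set_integral_tendsto_right:
  fixes f :: "real \<Rightarrow> real"
  assumes f: "set_integrable lborel {0..u} f"
    and T: "\<And>n. a \<le> T n" "\<And>n. T n \<le> u" "T \<longlonglongrightarrow> a"
  shows "(\<lambda>n. LBINT s:{0..T n}. f s) \<longlonglongrightarrow> (LBINT s:{0..a}. f s)"
  unfolding set_lebesgue_integral_def
proof (rule integral_dominated_convergence[where w = "\<lambda>s. \<bar>indicator {0..u} s *\<^sub>R f s\<bar>"])
  have sub: "set_integrable lborel {0..b} f" if "b \<le> u" for b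
    using f by (rule set_integrable_subset) (use that in auto)
  show "(\<lambda>s. indicator {0..a} s *\<^sub>R f s) \<in> borel_measurable lborel"
    using sub[of a] T(1,2)[of 0] by (auto simp: set_integrable_def)
  show "(\<lambda>s. indicator {0..T n} s *\<^sub>R f s) \<in> borel_measurable lborel" for n
    using sub[of "T n"] T(2) by (auto simp: set_integrable_def)
  show "integrable lborel (\<lambda>s. \<bar>indicator {0..u} s *\<^sub>R f s\<bar>)"
    using f by (auto simp: set_integrable_def intro!: integrable_abs)
  show "AE s in lborel. norm (indicator {0..T n} s *\<^sub>R f s) \<le> \<bar>indicator {0..u} s *\<^sub>R f s\<bar>" for n
    using T(2)[of n] by (auto simp: indicator_def)
  show "AE s in lborel. (\<lambda>n. indicator {0..T n} s *\<^sub>R f s) \<longlonglongrightarrow> indicator {0..a} s *\<^sub>R f s"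
  proof (intro AE_I2 tendsto_scaleR tendsto_const tendsto_eventually)
    fix s
    show "\<forall>\<^sub>F n in sequentially. indicator {0..T n} s = (indicator {0..a} s :: real)"
    proof (cases "s \<le> a")
      case True
      then have "s \<le> T n" for n using T(1)[of n] by linarith
      then show ?thesis using True by (simp add: indicator_def)
    next
      case False
      then have "\<forall>\<^sub>F n in sequentially. T n < s"
        using T(3) by (auto intro: order_tendstoD)
      then show ?thesis using False by (auto simp: indicator_def elim: eventually_mono)
    qed
  qed
qed

text \<open>Optional stopping at the leaving time \<tau>, through its discretizations, bounds the
  expectation of \<open>g (X \<tau>)\<close> plus the integral of \<open>- f\<close> up to \<tau> by
  1. Both terms are nonnegative, because \<open>f \<le> 0\<close> as long as the path is in
  \<open>C\<close>. Restricting to the event of staying, where \<open>\<tau> = u\<close>, gives the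
  claim.\<close>

lemma (in prob_space) martingale_problem_stay_bound:
  fixes X :: "real \<Rightarrow> 'a \<Rightarrow> 'e::t2_space" and f g :: "'e \<Rightarrow> real"
  assumes X: "\<And>s. 0 \<le> s \<Longrightarrow> X s \<in> measurable M borel"
    and path: "\<And>\<omega>. \<omega> \<in> space M \<Longrightarrow> cadlag (\<lambda>t. X t \<omega>)"
    and start: "AE \<omega> in M. X 0 \<omega> = x"
    and mart: "martingale M (natural_filtration (space M) X)
      (\<lambda>t \<omega>. g (X t \<omega>) - g (X 0 \<omega>) - (LBINT s:{0..t}. f (X s \<omega>)))"
    and f_int: "AE \<omega> in M. set_integrable lborel {0..u} (\<lambda>s. f (X s \<omega>))"
    and g: "continuous_on UNIV g" "\<And>y. 0 \<le> g y" "g x = 1"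
    and C: "closed C" "\<And>y. y \<in> C \<Longrightarrow> f y \<le> 0"
    and u: "0 \<le> u"
  shows "(\<integral>\<^sup>+\<omega>. indicator (stay (space M) X C u) \<omega> *
      ennreal (g (X u \<omega>) + (LBINT s:{0..u}. - f (X s \<omega>))) \<partial>M) \<le> 1"
proof -
  define Y where "Y = (\<lambda>t \<omega>. g (X t \<omega>) - g (X 0 \<omega>) - (LBINT s:{0..t}. f (X s \<omega>)))"
  define F where "F = natural_filtration (space M) X"
  define \<tau> where "\<tau> = leave_time X C u"
  define T where "T n \<omega> = grid_time n u (\<tau> \<omega>)" for n \<omega>
  define N where "N n \<omega> = Y (T n \<omega>) \<omega>" for n \<omega>
  \<comment> \<open>Taken as a limit of measurable functions, so that measurability is immediate; it
    agrees almost surely with the martingale stopped at \<tau>.\<close>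
  define N' where "N' \<omega> = lim (\<lambda>n. N n \<omega>)" for \<omega>
  have sub: "subalgebra M (F t)" for t
    unfolding F_def using X by (rule subalgebra_natural_filtration)
  have mart': "martingale M F Y"
    using mart by (simp add: F_def Y_def)
  have \<tau>: "0 \<le> \<tau> \<omega>" "\<tau> \<omega> \<le> u" for \<omega>
    using leave_time_bounds[OF u] by (auto simp: \<tau>_def)
  have T: "\<tau> \<omega> \<le> T n \<omega>" "T n \<omega> \<le> u" for n \<omega>
    using grid_time_bounds[OF \<tau>(2)] by (auto simp: T_def)
  have T_lim: "(\<lambda>n. T n \<omega>) \<longlonglongrightarrow> \<tau> \<omega>" for \<omega>
    unfolding T_def by (rule tendsto_grid_time[OF \<tau>(2)])
  have stop: "N n \<in> borel_measurable M"
    "(\<integral>\<omega>. N n \<omega> * damp k (N n \<omega>) \<partial>M) = (\<integral>\<omega>. Y u \<omega> * damp k (N n \<omega>) \<partial>M)" for n k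
  proof -
    let ?S = "grid_time n u ` {0..u}"
    have S: "?S \<subseteq> {0..u}"
    proof safe
      show "grid_time n u a \<in> {0..u}" if "a \<in> {0..u}" for a
        using that grid_time_bounds(1,2)[of a u n] by simp
    qed
    have 1: "T n \<omega> \<in> ?S" for \<omega>
      using \<tau> by (auto simp: T_def)
    have 2: "{\<omega> \<in> space M. T n \<omega> \<le> v} \<in> sets (F (ennreal v))" for v
      unfolding T_def \<tau>_def F_def using path C(1) u by (rule sets_grid_leave_time)
    have 3: "sets (F (ennreal v)) \<subseteq> sets (F (ennreal w))" if "v \<le> w" for v w
      unfolding F_def using that by (intro natural_filtration_mono ennreal_leI)
    note * = martingale_damped_stopping[OF sub mart' finite_grid_time S 1 2 3]
    show "N n \<in> borel_measurable M"
      unfolding N_def by (rule *(1))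
    show "(\<integral>\<omega>. N n \<omega> * damp k (N n \<omega>) \<partial>M) = (\<integral>\<omega>. Y u \<omega> * damp k (N n \<omega>) \<partial>M)"
      unfolding N_def by (rule *(2))
  qed
  have N'_meas: "N' \<in> borel_measurable M"
    unfolding N'_def using stop(1) by measurable
  have lim: "AE \<omega> in M. (\<lambda>n. N n \<omega>) \<longlonglongrightarrow> Y (\<tau> \<omega>) \<omega>"
    using f_int AE_space
  proof eventually_elim
    case (elim \<omega>)
    \<comment> \<open>The discretized times may coincide with \<tau>, so the right limit is restated
      as continuity on the closed half-line.\<close>
    have "{\<tau> \<omega>..} - {\<tau> \<omega>} = {\<tau> \<omega><..} - {\<tau> \<omega>}" by auto
    then have "at (\<tau> \<omega>) within {\<tau> \<omega>..} = at_right (\<tau> \<omega>)"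
      by (simp only: at_within_def)
    then have "continuous (at (\<tau> \<omega>) within {\<tau> \<omega>..}) (\<lambda>t. X t \<omega>)"
      using path[OF elim(2)] \<tau>(1)[of \<omega>] by (simp add: cadlag_def continuous_within)
    then have "(\<lambda>n. X (T n \<omega>) \<omega>) \<longlonglongrightarrow> X (\<tau> \<omega>) \<omega>"
      using T(1) T_lim by (intro continuous_within_tendsto_compose[where f = "\<lambda>t. X t \<omega>"]) auto
    then have "(\<lambda>n. g (X (T n \<omega>) \<omega>)) \<longlonglongrightarrow> g (X (\<tau> \<omega>) \<omega>)"
      using g(1) by (auto intro!: isCont_tendsto_compose[of _ g] simp: continuous_on_eq_continuous_at)
    moreover have "(\<lambda>n. LBINT s:{0..T n \<omega>}. f (X s \<omega>)) \<longlonglongrightarrow> (LBINT s:{0..\<tau> \<omega>}. f (X s \<omega>))"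
      using elim(1) T T_lim by (rule set_integral_tendsto_right)
    ultimately show ?case
      unfolding N_def Y_def by (intro tendsto_intros)
  qed
  have N'_eq: "AE \<omega> in M. N' \<omega> = g (X (\<tau> \<omega>) \<omega>) - 1 + (LBINT s:{0..\<tau> \<omega>}. - f (X s \<omega>))"
    using lim start
  proof eventually_elim
    case (elim \<omega>)
    have "N' \<omega> = Y (\<tau> \<omega>) \<omega>"
      unfolding N'_def using elim(1) by (rule limI)
    then show ?case
      using elim(2) g(3) by (simp add: Y_def set_lebesgue_integral_def)
  qed
  have nonneg: "0 \<le> (LBINT s:{0..\<tau> \<omega>}. - f (X s \<omega>))" for \<omega>
  proof -
    \<comment> \<open>At \<tau> itself the path may already be outside \<open>C\<close>, where the
      sign of \<open>f\<close> is unknown; a single time is a null set.\<close>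
    have "AE s in lborel. s \<noteq> \<tau> \<omega>" by (rule AE_lborel_singleton)
    then have "AE s in lborel. 0 \<le> indicator {0..\<tau> \<omega>} s *\<^sub>R - f (X s \<omega>)"
    proof eventually_elim
      case (elim s)
      then show ?case
        using before_leave_time[of s X C u \<omega>] C(2) u by (auto simp: indicator_def \<tau>_def)
    qed
    then show ?thesis
      unfolding set_lebesgue_integral_def by (rule integral_nonneg_AE)
  qed
  have EY: "integrable M (Y u)" "(\<integral>\<omega>. Y u \<omega> \<partial>M) = 0"
  proof -
    show int: "integrable M (Y u)"
      using mart' u by (auto simp: martingale_def)
    interpret S: finite_measure_subalgebra M "F (ennreal 0)"
      by standard (rule sub)
    have Y0: "Y 0 \<omega> = 0" for \<omega>
    proof -
      have "(LBINT s:{0..0::real}. f (X s \<omega>)) = 0"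
        unfolding set_lebesgue_integral_def
        by (rule integral_eq_zero_AE, rule eventually_mono[OF AE_lborel_singleton[of 0]])
           (auto simp: indicator_def)
      then show ?thesis by (simp add: Y_def)
    qed
    have "(\<integral>\<omega>. Y u \<omega> \<partial>M) = (\<integral>\<omega>. real_cond_exp M (F (ennreal 0)) (Y u) \<omega> \<partial>M)"
      using S.real_cond_exp_int(2)[OF int] by simp
    also have "\<dots> = (\<integral>\<omega>. Y 0 \<omega> \<partial>M)"
      using mart' u by (intro integral_cong_AE) (auto simp: martingale_def)
    finally show "(\<integral>\<omega>. Y u \<omega> \<partial>M) = 0" by (simp add: Y0)
  qed
  have "(\<integral>\<^sup>+\<omega>. indicator (stay (space M) X C u) \<omega> *
      ennreal (g (X u \<omega>) + (LBINT s:{0..u}. - f (X s \<omega>))) \<partial>M) \<le> (\<integral>\<^sup>+\<omega>. ennreal (N' \<omega> + 1) \<partial>M)"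
  proof (rule nn_integral_mono_AE)
    show "AE \<omega> in M. indicator (stay (space M) X C u) \<omega> *
      ennreal (g (X u \<omega>) + (LBINT s:{0..u}. - f (X s \<omega>))) \<le> ennreal (N' \<omega> + 1)"
      using N'_eq by eventually_elim (auto simp: indicator_def \<tau>_def leave_time_stay)
  qed
  also have "\<dots> \<le> ennreal ((\<integral>\<omega>. Y u \<omega> \<partial>M) + 1)"
  proof (rule nn_integral_damped_limit_le[OF EY(1) stop(1) N'_meas _ stop(2)])
    show "AE \<omega> in M. (\<lambda>n. N n \<omega>) \<longlonglongrightarrow> N' \<omega>"
      using lim by eventually_elim (simp add: N'_def limI)
    show "AE \<omega> in M. - 1 \<le> N' \<omega>"
      using N'_eq by eventually_elim (use g(2) nonneg in \<open>simp add: add_nonneg_nonneg\<close>)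
  qed
  finally show ?thesis using EY(2) by simp
qed

section \<open>The exit time bound\<close>

text \<open>Near \<open>z\<close> the cutoff is constantly 1, so gradient and Hessian vanish at
  \<open>z\<close>: drift, diffusion and compensator drop out, and only the jump integral of
  \<open>g (z + y) - 1\<close> is left.\<close>

lemma levy_operator_cutoff:
  fixes b :: "real^'d::finite \<Rightarrow> real^'d"
  assumes lm: "levy_measure (nu z)"
    and g: "continuous_on UNIV g" "\<And>y. 0 \<le> g y" "\<And>y. g y \<le> 1"
    and one: "\<And>y. y \<in> ball x a \<Longrightarrow> g y = 1"
    and z: "z \<in> ball x a"
  shows "levy_operator b Q nu g z \<le> 0"
    and "ennreal (- levy_operator b Q nu g z) = (\<integral>\<^sup>+y. ennreal (1 - g (z + y)) \<partial>nu z)"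
proof -
  have sets: "sets (nu z) = sets (restrict_space borel (- {0}))"
    and fin: "(\<integral>\<^sup>+y. ennreal (min 1 ((norm y)\<^sup>2)) \<partial>nu z) < \<infinity>"
    using lm by (auto simp: levy_measure_def)
  have meas: "h \<in> borel_measurable (nu z)" if "continuous_on UNIV h" for h :: "real^'d \<Rightarrow> real"
  proof -
    have "h \<in> borel_measurable (restrict_space borel (- {0}))"
      using that by (intro measurable_restrict_space1 borel_measurable_continuous_onI)
    then show ?thesis using measurable_cong_sets[OF sets refl] by blast
  qed
  have d0: "partial_deriv i g w = 0" if "w \<in> ball x a" for i w
    using one that by (intro partial_deriv_locally_const[OF open_ball]) auto
  have "grad g z = 0"
    using d0[OF z] by (simp add: grad_def vec_eq_iff)
  moreover have "partial_deriv i (partial_deriv j g) z = 0" for i j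
    using d0 z by (intro partial_deriv_locally_const[OF open_ball]) auto
  then have "hessian g z = 0"
    by (simp add: hessian_def vec_eq_iff)
  moreover have "Q z ** 0 = (0 :: real^'d^'d)"
    by (simp add: matrix_matrix_mult_def vec_eq_iff)
  ultimately have "levy_operator b Q nu g z = (\<integral>y. g (z + y) - 1 \<partial>nu z)"
    using one[OF z] by (simp add: levy_operator_def trace_def)
  then have eq: "- levy_operator b Q nu g z = (\<integral>y. 1 - g (z + y) \<partial>nu z)"
    using Bochner_Integration.integral_minus[where M = "nu z" and f = "\<lambda>y. g (z + y) - 1"] by simp
  \<comment> \<open>Jumps shorter than \<delta> stay in the ball where \<open>g\<close> is 1. For
    the others the cap at 1 gives \<open>\<delta>\<^sup>2 \<le> min 1 ((norm y)\<^sup>2)\<close>, so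
    the integrand is dominated by a multiple of the integrable function of a Levy measure.\<close>
  define \<delta> where "\<delta> = min 1 (a - dist x z)"
  have \<delta>: "0 < \<delta>" "\<delta> \<le> 1" using z by (auto simp: \<delta>_def)
  have bound: "1 - g (z + y) \<le> (1 / \<delta>\<^sup>2) * min 1 ((norm y)\<^sup>2)" for y
  proof (cases "norm y < \<delta>")
    case True
    have "dist x (z + y) \<le> dist x z + norm y"
      using dist_triangle[of x "z + y" z] by (simp add: dist_norm)
    then have "z + y \<in> ball x a" using True by (simp add: \<delta>_def)
    then show ?thesis using one by simp
  next
    case False
    then have "\<delta>\<^sup>2 \<le> (norm y)\<^sup>2" using \<delta> by (intro power_mono) auto
    moreover have "\<delta>\<^sup>2 \<le> 1" using \<delta> by (simp add: power_le_one)
    ultimately have "1 \<le> (1 / \<delta>\<^sup>2) * min 1 ((norm y)\<^sup>2)" using \<delta> by simp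
    then show ?thesis using g(2)[of "z + y"] by linarith
  qed
  have "integrable (nu z) (\<lambda>y. min 1 ((norm y)\<^sup>2))"
    using fin by (intro integrableI_bounded meas) (auto intro!: continuous_intros)
  then have "integrable (nu z) (\<lambda>y. (1 / \<delta>\<^sup>2) * min 1 ((norm y)\<^sup>2))"
    by (rule integrable_mult_right)
  then have int: "integrable (nu z) (\<lambda>y. 1 - g (z + y))"
  proof (rule Bochner_Integration.integrable_bound)
    show "(\<lambda>y. 1 - g (z + y)) \<in> borel_measurable (nu z)"
      by (intro meas continuous_intros continuous_on_compose2[OF g(1)]) auto
    show "AE y in nu z. norm (1 - g (z + y)) \<le> norm (1 / \<delta>\<^sup>2 * min 1 ((norm y)\<^sup>2))"
      using g(3) bound by (intro AE_I2) (simp add: abs_of_nonneg order_trans[OF _ abs_ge_self])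
  qed
  show "levy_operator b Q nu g z \<le> 0"
  proof -
    have "0 \<le> (\<integral>y. 1 - g (z + y) \<partial>nu z)"
      using g(3) by (intro Bochner_Integration.integral_nonneg) auto
    then show ?thesis using eq by linarith
  qed
  show "ennreal (- levy_operator b Q nu g z) = (\<integral>\<^sup>+y. ennreal (1 - g (z + y)) \<partial>nu z)"
    unfolding eq using g(3) by (intro nn_integral_eq_integral[symmetric] int) auto
qed

text \<open>A jump longer than \<open>2 * r\<close> from a point of \<open>cball x r\<close> lands
  at distance strictly more than \<open>r\<close> from \<open>x\<close>, where the cutoffs are
  eventually 0 because their radii tend to \<open>r\<close>. Fatou's lemma then bounds the tail of
  \<open>nu z\<close>, which is one of the competitors in the infimum.\<close>

lemma levy_tail_le_liminf:
  fixes nu :: "real^'d::finite \<Rightarrow> (real^'d) measure"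
  assumes lm: "levy_measure (nu z)"
    and g: "\<And>n. continuous_on UNIV (g n)"
    and zero: "\<And>n y. y \<notin> ball x (\<rho> n) \<Longrightarrow> g n y = 0" "\<rho> \<longlonglongrightarrow> r"
    and z: "z \<in> cball x r" and r: "0 < r"
  shows "G_lower nu x (2 * r) \<le> liminf (\<lambda>n. \<integral>\<^sup>+y. ennreal (1 - g n (z + y)) \<partial>nu z)"
proof -
  have sets: "sets (nu z) = sets (restrict_space borel (- {0}))"
    using lm by (auto simp: levy_measure_def)
  have meas: "(\<lambda>y. ennreal (1 - g n (z + y))) \<in> borel_measurable (nu z)" for n
  proof -
    have "(\<lambda>y. ennreal (1 - g n (z + y))) \<in> borel_measurable (restrict_space borel (- {0}))"
      by (intro measurable_restrict_space1 measurable_compose[OF _ measurable_ennreal]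
          borel_measurable_continuous_onI continuous_intros continuous_on_compose2[OF g]) auto
    then show ?thesis using measurable_cong_sets[OF sets refl] by blast
  qed
  have tail: "{y. 2 * r < norm y} \<in> sets (nu z)"
    unfolding sets using r by (subst sets_restrict_space_iff) auto
  have "z \<in> cball x (2 * r)" using z r by auto
  then have "G_lower nu x (2 * r) \<le> emeasure (nu z) {y. 2 * r < norm y}"
    unfolding G_lower_def by (rule INF_lower)
  also have "\<dots> = (\<integral>\<^sup>+y. indicator {y. 2 * r < norm y} y \<partial>nu z)"
    using tail by simp
  also have "\<dots> \<le> (\<integral>\<^sup>+y. liminf (\<lambda>n. ennreal (1 - g n (z + y))) \<partial>nu z)"
  proof (rule nn_integral_mono)
    fix y
    show "indicator {y. 2 * r < norm y} y \<le> liminf (\<lambda>n. ennreal (1 - g n (z + y)))"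
    proof (cases "2 * r < norm y")
      case True
      have "norm y \<le> dist x (z + y) + dist x z"
        using dist_triangle[of "z + y" z x] by (simp add: dist_norm norm_minus_commute)
      then have "r < dist x (z + y)" using True z by simp
      then have "\<forall>\<^sub>F n in sequentially. \<rho> n < dist x (z + y)"
        using zero(2) by (auto intro: order_tendstoD)
      then have "\<forall>\<^sub>F n in sequentially. 1 \<le> ennreal (1 - g n (z + y))"
        by eventually_elim (simp add: zero(1))
      then show ?thesis using True by (auto intro: Liminf_bounded)
    qed simp
  qed
  also have "\<dots> \<le> liminf (\<lambda>n. \<integral>\<^sup>+y. ennreal (1 - g n (z + y)) \<partial>nu z)"
    by (rule nn_integral_liminf[OF meas])
  finally show ?thesis .
qed

lemma levy_type_process_stay_bound:
  fixes X :: "real \<Rightarrow> 'w \<Rightarrow> real^'d::finite"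
  assumes proc: "levy_type_process M X P b Q nu"
    and u: "0 \<le> u" and r: "0 < r"
  shows "stay (space M) X (cball x r) u \<in> sets (P x)"
    and "emeasure (P x) (stay (space M) X (cball x r) u) \<le> 1 / (1 + ennreal u * G_lower nu x (2 * r))"
proof -
  \<comment> \<open>The cutoff falls from 1 to 0 between the radii \<open>\<rho> 1 n\<close> and
    \<open>\<rho> 2 n\<close>. The inner one exceeds \<open>r\<close>, so the cutoff is 1 near every
    point of \<open>cball x r\<close>; the outer one tends to \<open>r\<close>.\<close>
  define \<rho> where "\<rho> k n = r + k / real (Suc n)" for k n
  have \<rho>: "0 < \<rho> 1 n" "\<rho> 1 n < \<rho> 2 n" "r < \<rho> 1 n" for n
    using r by (auto simp: \<rho>_def divide_strict_right_mono add_pos_pos simp del: of_nat_Suc)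
  have \<rho>_lim: "\<rho> 2 \<longlonglongrightarrow> r"
    unfolding \<rho>_def using tendsto_add[OF tendsto_const LIMSEQ_Suc[OF lim_const_over_n[of 2]], of r] by simp
  have "\<forall>n. \<exists>g. g \<in> Cc_infinity \<and> (\<forall>y. 0 \<le> g y) \<and> (\<forall>y. g y \<le> 1) \<and>
      (\<forall>y\<in>cball x (\<rho> 1 n). g y = 1) \<and> (\<forall>y. y \<notin> ball x (\<rho> 2 n) \<longrightarrow> g y = 0)"
    using smooth_cutoff[OF \<rho>(1,2)] by metis
  then obtain g where g: "\<And>n. g n \<in> Cc_infinity" "\<And>n y. 0 \<le> g n y" "\<And>n y. g n y \<le> 1"
    "\<And>n y. y \<in> cball x (\<rho> 1 n) \<Longrightarrow> g n y = 1" "\<And>n y. y \<notin> ball x (\<rho> 2 n) \<Longrightarrow> g n y = 0"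
    by metis
  have g_cont: "continuous_on UNIV (g n)" for n
  proof -
    have "C_k 0 (g n)" using g(1)[of n] unfolding Cc_infinity_def by blast
    then show ?thesis by simp
  qed
  define f where "f n = levy_operator b Q nu (g n)" for n
  let ?E = "stay (space M) X (cball x r) u"
  let ?G = "G_lower nu x (2 * r)"
  have sets_P: "sets (P x) = sets M" and prob: "prob_space (P x)"
    and path: "\<And>\<omega>. \<omega> \<in> space M \<Longrightarrow> cadlag (\<lambda>t. X t \<omega>)"
    and X_M: "\<And>s. 0 \<le> s \<Longrightarrow> X s \<in> measurable M borel"
    using proc by (auto simp: levy_type_process_def cadlag_family_def)
  interpret prob_space "P x" by (rule prob)
  have space_P: "space (P x) = space M"
    using sets_P by (rule sets_eq_imp_space_eq)
  have X_P: "X s \<in> measurable (P x) borel" if "0 \<le> s" for s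
    using X_M[OF that] measurable_cong_sets[OF sets_P refl] by blast
  have levy: "levy_measure (nu z)" for z
    using proc by (auto simp: levy_type_process_def levy_characteristics_def)
  have mp: "solves_martingale_problem M X (P x) x (levy_operator b Q nu)"
    using proc by (auto simp: levy_type_process_def)
  have start: "AE \<omega> in P x. X 0 \<omega> = x"
    using mp by (simp add: solves_martingale_problem_def)
  have mart: "martingale (P x) (natural_filtration (space M) X)
      (\<lambda>t \<omega>. g n (X t \<omega>) - g n (X 0 \<omega>) - (LBINT s:{0..t}. f n (X s \<omega>)))"
    and f_int: "AE \<omega> in P x. set_integrable lborel {0..u} (\<lambda>s. f n (X s \<omega>))" for n
    using mp g(1)[of n] u by (auto simp: solves_martingale_problem_def f_def)
  have in_ball: "z \<in> ball x (\<rho> 1 n)" if "z \<in> cball x r" for z n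
    using that \<rho>(3)[of n] by auto
  have f_nonpos: "f n z \<le> 0"
    and f_eq: "ennreal (- f n z) = (\<integral>\<^sup>+y. ennreal (1 - g n (z + y)) \<partial>nu z)"
    if "z \<in> cball x r" for n z
    unfolding f_def using levy g_cont g(2-4) in_ball[OF that]
    by (intro levy_operator_cutoff[where x = x and a = "\<rho> 1 n"]; auto)+
  show E: "?E \<in> sets (P x)"
    using sets_stay[where M = "P x" and X = X and C = "cball x r" and u = u] X_P path u
    by (simp add: space_P)
  let ?I = "\<lambda>n \<omega>. LBINT s:{0..u}. - f n (X s \<omega>)"
  \<comment> \<open>The martingale is measurable and so are its boundary terms, hence so is the time
    integral that is their difference.\<close>
  have I_meas: "?I n \<in> borel_measurable (P x)" for n
  proof -
    have Y: "(\<lambda>\<omega>. g n (X u \<omega>) - g n (X 0 \<omega>) - (LBINT s:{0..u}. f n (X s \<omega>))) \<in> borel_measurable (P x)"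
      using mart[of n] u by (auto simp: martingale_def)
    have gX: "(\<lambda>\<omega>. g n (X s \<omega>)) \<in> borel_measurable (P x)" if "0 \<le> s" for s
      using X_P[OF that] borel_measurable_continuous_onI[OF g_cont] by (rule measurable_compose)
    show ?thesis
      using borel_measurable_add[OF borel_measurable_diff[OF Y gX[OF u]] gX[OF order_refl]]
      by (simp add: set_lebesgue_integral_def)
  qed
  \<comment> \<open>On the event of staying, \<open>X u\<close> lies where the cutoff is 1, so its
    value can be replaced by 1.\<close>
  have bound: "(\<integral>\<^sup>+\<omega>. indicator ?E \<omega> * ennreal (1 + ?I n \<omega>) \<partial>P x) \<le> 1" for n
  proof -
    have "(\<integral>\<^sup>+\<omega>. indicator ?E \<omega> * ennreal (1 + ?I n \<omega>) \<partial>P x)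
        = (\<integral>\<^sup>+\<omega>. indicator ?E \<omega> * ennreal (g n (X u \<omega>) + ?I n \<omega>) \<partial>P x)"
      using g(4)[of _ n] u \<rho>(3)[of n]
      by (intro nn_integral_cong) (auto simp: indicator_def stay_def)
    also have "\<dots> \<le> 1"
      using martingale_problem_stay_bound[where X = X and x = x and g = "g n" and f = "f n" and C = "cball x r"]
        X_P path start mart f_int g_cont g(2,4) f_nonpos u \<rho>(1)[of n]
      by (simp add: space_P less_imp_le)
    finally show ?thesis .
  qed
  have lower: "AE \<omega> in P x. indicator ?E \<omega> * (1 + ennreal u * ?G)
      \<le> liminf (\<lambda>n. indicator ?E \<omega> * ennreal (1 + ?I n \<omega>))"
  proof -
    have "AE \<omega> in P x. \<forall>n. set_integrable lborel {0..u} (\<lambda>s. f n (X s \<omega>))"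
      using f_int by (simp add: AE_all_countable)
    then show ?thesis
    proof eventually_elim
      case (elim \<omega>)
      show ?case
      proof (cases "\<omega> \<in> ?E")
        case True
        then have stays: "X s \<omega> \<in> cball x r" if "s \<in> {0..u}" for s
          using that by (auto simp: stay_def)
        let ?h = "\<lambda>n s. indicator {0..u} s *\<^sub>R - f n (X s \<omega>)"
        have h_int: "integrable lborel (?h n)" for n
          using elim by (auto simp: set_integrable_def)
        have h_nonneg: "0 \<le> ?h n s" for n s
          using f_nonpos stays by (auto simp: indicator_def)
        have I_eq: "ennreal (?I n \<omega>) = (\<integral>\<^sup>+s. ennreal (?h n s) \<partial>lborel)" for n
          unfolding set_lebesgue_integral_def
          using h_int h_nonneg by (intro nn_integral_eq_integral[symmetric]) auto
        have I_nonneg: "0 \<le> ?I n \<omega>" for n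
          unfolding set_lebesgue_integral_def using h_nonneg by (rule Bochner_Integration.integral_nonneg)
        \<comment> \<open>Fatou's lemma in the time variable along a fixed path that stays in the
          ball: at each time the liminf of the integrands is at least \<open>?G\<close>.\<close>
        have "ennreal u * ?G = (\<integral>\<^sup>+s. ?G * indicator {0..u} s \<partial>lborel)"
          using u by (subst nn_integral_cmult_indicator) (auto simp: mult.commute)
        also have "\<dots> \<le> (\<integral>\<^sup>+s. liminf (\<lambda>n. ennreal (?h n s)) \<partial>lborel)"
        proof (rule nn_integral_mono)
          fix s
          show "?G * indicator {0..u} s \<le> liminf (\<lambda>n. ennreal (?h n s))"
          proof (cases "s \<in> {0..u}")
            case True
            then show ?thesis
              using levy_tail_le_liminf[OF levy g_cont g(5) \<rho>_lim stays[OF True] r] f_eq[OF stays[OF True]]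
              by simp
          qed simp
        qed
        also have "\<dots> \<le> liminf (\<lambda>n. \<integral>\<^sup>+s. ennreal (?h n s) \<partial>lborel)"
          using h_int by (intro nn_integral_liminf) auto
        finally have "ennreal u * ?G \<le> liminf (\<lambda>n. ennreal (?I n \<omega>))"
          by (simp add: I_eq)
        then have "1 + ennreal u * ?G \<le> 1 + liminf (\<lambda>n. ennreal (?I n \<omega>))"
          by (rule add_left_mono)
        also have "\<dots> = liminf (\<lambda>n. 1 + ennreal (?I n \<omega>))"
          by (rule Liminf_const_add[symmetric]) simp
        finally show ?thesis
          using True I_nonneg by (simp add: ennreal_plus)
      qed simp
    qed
  qed
  \<comment> \<open>A second use of Fatou's lemma, now over the paths.\<close>
  have "emeasure (P x) ?E * (1 + ennreal u * ?G) = (\<integral>\<^sup>+\<omega>. indicator ?E \<omega> * (1 + ennreal u * ?G) \<partial>P x)"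
    using E by (simp add: nn_integral_multc)
  also have "\<dots> \<le> (\<integral>\<^sup>+\<omega>. liminf (\<lambda>n. indicator ?E \<omega> * ennreal (1 + ?I n \<omega>)) \<partial>P x)"
    using lower by (rule nn_integral_mono_AE)
  also have "\<dots> \<le> liminf (\<lambda>n. \<integral>\<^sup>+\<omega>. indicator ?E \<omega> * ennreal (1 + ?I n \<omega>) \<partial>P x)"
    by (intro nn_integral_liminf borel_measurable_times_ennreal borel_measurable_indicator E
        measurable_compose[OF _ measurable_ennreal] borel_measurable_add borel_measurable_const I_meas)
  also have "\<dots> \<le> 1"
    using bound by (intro Liminf_le) auto
  finally have main: "emeasure (P x) ?E * (1 + ennreal u * ?G) \<le> 1" .
  show "emeasure (P x) ?E \<le> 1 / (1 + ennreal u * ?G)"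
  \<comment> \<open>An infinite factor forces the probability to be 0, in agreement with
    \<open>1 / \<infinity> = 0\<close>.\<close>
  proof (cases "1 + ennreal u * ?G = \<infinity>")
    case True
    then show ?thesis using main by (auto simp: ennreal_mult_eq_top_iff ennreal_mult_top top_unique split: if_splits)
  next
    case False
    have "emeasure (P x) ?E = emeasure (P x) ?E * (1 + ennreal u * ?G) / (1 + ennreal u * ?G)"
      using False by (intro ennreal_mult_divide_eq[symmetric]) auto
    also have "\<dots> \<le> 1 / (1 + ennreal u * ?G)"
      using main by (rule divide_right_mono_ennreal)
    finally show ?thesis .
  qed
qed

theorem proposition4p2:
  fixes M :: "'w measure"
    and X :: "real \<Rightarrow> 'w \<Rightarrow> real^'d::finite"
    and P :: "real^'d \<Rightarrow> 'w measure"
    and b :: "real^'d \<Rightarrow> real^'d"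
    and Q :: "real^'d \<Rightarrow> real^'d^'d"
    and nu :: "real^'d \<Rightarrow> (real^'d) measure"
    and x :: "real^'d"
    and t r :: real
  assumes "levy_type_process M X P b Q nu"
    and "t > 0"
    and "r > 0"
  shows "outer_measure_of (P x) {\<omega> \<in> space M. ennreal t \<le> exit_time X x r \<omega>}
           \<le> 1 / (1 + ennreal t * G_lower nu x (2 * r))"
proof -
  let ?A = "{\<omega> \<in> space M. ennreal t \<le> exit_time X x r \<omega>}"
  let ?G = "G_lower nu x (2 * r)"
  \<comment> \<open>Times strictly below \<open>t\<close>: at \<open>t\<close> itself the process
    may already have jumped out of the closed ball while the exit time still equals
    \<open>t\<close>.\<close>
  define u where "u n = t * (1 - 1 / real (Suc n))" for n
  have u: "0 \<le> u n" "u n < t" for n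
    using assms(2) by (auto simp: u_def)
  have u_lim: "u \<longlonglongrightarrow> t"
  proof -
    have "u \<longlonglongrightarrow> t * (1 - 0)"
      unfolding u_def by (intro tendsto_intros LIMSEQ_Suc[OF lim_const_over_n])
    then show ?thesis by simp
  qed
  have "outer_measure_of (P x) ?A \<le> 1 / (1 + ennreal (u n) * ?G)" for n
  proof -
    have "?A \<subseteq> stay (space M) X (cball x r) (u n)"
    proof
      fix \<omega> assume \<omega>: "\<omega> \<in> ?A"
      have "X s \<omega> \<in> cball x r" if s: "0 \<le> s" "s \<le> u n" for s
      proof (rule ccontr)
        assume "X s \<omega> \<notin> cball x r"
        then have "exit_time X x r \<omega> \<le> ennreal s"
          unfolding exit_time_def using s by (intro Inf_lower) (auto simp: dist_norm norm_minus_commute)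
        moreover have "ennreal s < ennreal t"
          using s u(2)[of n] by (intro ennreal_lessI) auto
        ultimately show False using \<omega> by auto
      qed
      then show "\<omega> \<in> stay (space M) X (cball x r) (u n)"
        using \<omega> by (simp add: stay_def)
    qed
    \<comment> \<open>The larger event is measurable, so its outer measure is its
      probability.\<close>
    then have "outer_measure_of (P x) ?A \<le> outer_measure_of (P x) (stay (space M) X (cball x r) (u n))"
      by (rule outer_measure_of_mono)
    also have "\<dots> = emeasure (P x) (stay (space M) X (cball x r) (u n))"
      using levy_type_process_stay_bound(1)[OF assms(1) u(1) assms(3)] by simp
    also have "\<dots> \<le> 1 / (1 + ennreal (u n) * ?G)"
      by (rule levy_type_process_stay_bound(2)[OF assms(1) u(1) assms(3)])
    finally show ?thesis .
  qed
  moreover have "(\<lambda>n. 1 / (1 + ennreal (u n) * ?G)) \<longlonglongrightarrow> 1 / (1 + ennreal t * ?G)"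
  proof -
    have "isCont inverse (1 + ennreal t * ?G)"
      using continuous_on_inverse_ennreal[OF continuous_on_id, of UNIV]
      by (simp add: continuous_on_eq_continuous_at)
    \<comment> \<open>As \<open>t > 0\<close>, the product is continuous at this point even when
      \<open>?G\<close> is infinite.\<close>
    moreover have "(\<lambda>n. 1 + ennreal (u n) * ?G) \<longlonglongrightarrow> 1 + ennreal t * ?G"
      using u_lim assms(2) by (intro tendsto_intros) auto
    ultimately show ?thesis
      unfolding divide_ennreal_def mult_1 by (rule isCont_tendsto_compose)
  qed
  ultimately show ?thesis
    by (intro LIMSEQ_le_const) auto
qed

end
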